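(* Let $\mathbb{K}$ be a field. For almost all graphs $G$, $G$ is not Cohen--Macaulay (over $\mathbb{K}$). That is, for every fixed $p\in(0,1)$, if $G$ is a random graph of order $n$ with edge probability $p$, then the probability that $\mathbb{K}[x_1,\ldots,x_n]/I(G)$ is not a Cohen--Macaulay ring tends to $1$ as $n\to\infty$.
   Context: A random graph of order $n$ (with fixed $p\in(0,1)$) is a graph on $\{x_1,\ldots,x_n\}$ in which each pair $\{x_i,x_j\}$, $1\leq i<j\leq n$, is an edge independently with probability $p$. "Almost all graphs have property $P$" means that for every $0<p<1$, $\mathrm{Prob}(G \text{ has property } P)\to 1$ as $n=|V|\to\infty$. The edge ideal of $G$ is $I(G)=\langle x_ix_j : \{x_i,x_j\}\in E(G)\rangle\subseteq R=\mathbb{K}[x_1,\ldots,x_n]$. The graph $G$ is Cohen--Macaulay if the ring $S=R/I(G)$ is Cohen--Macaulay, i.e. $\dim S=\mathrm{depth}\,S$. *)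

theory Defs
  imports
    "HOL-Probability.Product_PMF"
    "HOL-Algebra.QuotRing"
    "HOL-Library.Poly_Mapping"
    "HOL-Library.Extended_Nat"
begin

section \<open>Krull dimension, regular sequences and depth\<close>

text \<open>
  The supremum of the lengths \<open>d\<close> of chains \<open>P\<^sub>0 \<subset> \<dots> \<subset> P\<^sub>d\<close> of prime ideals.
  (The zero ring, which has no prime ideals, gets the value 0 instead of the customary
  minus infinity.)
\<close>

definition krull_dim :: "('a, 'b) ring_scheme \<Rightarrow> enat" where
  "krull_dim R = Sup {enat d | d. \<exists>P :: nat \<Rightarrow> 'a set.
     (\<forall>i\<le>d. primeideal (P i) R) \<and> (\<forall>i<d. P i \<subset> P (Suc i))}"

text \<open>
  The second conjunct says that, for every \<open>i\<close>, the element \<open>xs ! i\<close> is a nonzerodivisor on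
  the quotient of \<open>R\<close> by the ideal generated by the preceding elements; the third one that
  the quotient by the whole sequence is nonzero.
\<close>

definition regular_sequence :: "('a, 'b) ring_scheme \<Rightarrow> 'a list \<Rightarrow> bool" where
  "regular_sequence R xs \<longleftrightarrow>
     set xs \<subseteq> carrier R \<and>
     (\<forall>i<length xs. \<forall>a\<in>carrier R.
        xs ! i \<otimes>\<^bsub>R\<^esub> a \<in> Idl\<^bsub>R\<^esub> (set (take i xs)) \<longrightarrow> a \<in> Idl\<^bsub>R\<^esub> (set (take i xs))) \<and>
     Idl\<^bsub>R\<^esub> (set xs) \<noteq> carrier R"

definition depth :: "('a, 'b) ring_scheme \<Rightarrow> 'a set \<Rightarrow> enat" where
  "depth R \<mm> = Sup {enat (length xs) | xs. regular_sequence R xs \<and> set xs \<subseteq> \<mm>}"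


section \<open>Edge ideals and Cohen--Macaulay graphs\<close>

text \<open>
  A monomial is its exponent vector, of type \<open>nat \<Rightarrow>\<^sub>0 nat\<close>, and a polynomial maps monomials
  to coefficients; the variables are indexed by all natural numbers. The ring
  \<open>K[x\<^sub>1, \<dots>, x\<^sub>n]\<close> consists of the polynomials in which only the variables
  \<open>1, \<dots>, n\<close> occur.
\<close>

type_synonym 'k mpoly = "(nat \<Rightarrow>\<^sub>0 nat) \<Rightarrow>\<^sub>0 'k"

definition poly_ring :: "nat \<Rightarrow> 'k::field mpoly ring" where
  "poly_ring n = \<lparr>carrier = {f. \<forall>m\<in>Poly_Mapping.keys f. Poly_Mapping.keys m \<subseteq> {1..n}},
     mult = (*), one = 1, zero = 0, add = (+)\<rparr>"

definition Var :: "nat \<Rightarrow> 'k::field mpoly" where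
  "Var i = Poly_Mapping.single (Poly_Mapping.single i 1) 1"

text \<open>A graph on the vertex set \<open>{1..n}\<close> is given by its set of edges, each of them a
  two-element set of vertices.\<close>

definition edge_ideal :: "nat \<Rightarrow> nat set set \<Rightarrow> 'k::field mpoly set" where
  "edge_ideal n E = Idl\<^bsub>poly_ring n\<^esub> {Var i * Var j | i j. {i, j} \<in> E}"

definition edge_ring :: "nat \<Rightarrow> nat set set \<Rightarrow> 'k::field mpoly set ring" where
  "edge_ring n E = poly_ring n Quot edge_ideal n E"

text \<open>The ideal of the edge ring generated by the residue classes of the variables.\<close>

definition irrelevant_ideal :: "nat \<Rightarrow> nat set set \<Rightarrow> 'k::field mpoly set set" where
  "irrelevant_ideal n E =
     Idl\<^bsub>edge_ring n E\<^esub> {edge_ideal n E +>\<^bsub>poly_ring n\<^esub> Var i | i. i \<in> {1..n}}"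

text \<open>
  As usual for a standard graded algebra, the depth of the edge ring is taken with respect to
  its irrelevant maximal ideal. The type argument records the coefficient field.
\<close>

definition cohen_macaulay_graph :: "'k::field itself \<Rightarrow> nat \<Rightarrow> nat set set \<Rightarrow> bool" where
  "cohen_macaulay_graph _ n E \<longleftrightarrow>
     krull_dim (edge_ring n E :: 'k mpoly set ring) =
     depth (edge_ring n E :: 'k mpoly set ring) (irrelevant_ideal n E)"


section \<open>Random graphs\<close>

definition vertex_pairs :: "nat \<Rightarrow> nat set set" where
  "vertex_pairs n = {{i, j} | i j. 1 \<le> i \<and> i < j \<and> j \<le> n}"

text \<open>The distribution of the edge set when each pair is an edge independently with
  probability \<open>p\<close>.\<close>

definition random_graph :: "nat \<Rightarrow> real \<Rightarrow> nat set set pmf" where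
  "random_graph n p =
     map_pmf (\<lambda>f. {e \<in> vertex_pairs n. f e})
       (Pi_pmf (vertex_pairs n) False (\<lambda>_. bernoulli_pmf p))"


section \<open>Well-definedness\<close>

lemma cring_poly_ring: "cring (poly_ring n :: 'k::field mpoly ring)"
proof -
  let ?R = "poly_ring n :: 'k mpoly ring"
  have add_closed: "f + g \<in> carrier ?R" if "f \<in> carrier ?R" "g \<in> carrier ?R" for f g
    using that subsetD[OF Poly_Mapping.keys_add[of f g]] by (force simp: poly_ring_def)
  have mult_closed: "f * g \<in> carrier ?R" if fg: "f \<in> carrier ?R" "g \<in> carrier ?R" for f g
  proof -
    have "Poly_Mapping.keys m \<subseteq> {1..n}" if "m \<in> Poly_Mapping.keys (f * g)" for m
    proof -
      obtain a b where ab: "m = a + b" "a \<in> Poly_Mapping.keys f" "b \<in> Poly_Mapping.keys g"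
        using \<open>m \<in> Poly_Mapping.keys (f * g)\<close> Poly_Mapping.keys_mult[of f g] by blast
      have "Poly_Mapping.keys a \<subseteq> {1..n}" "Poly_Mapping.keys b \<subseteq> {1..n}"
        using fg ab unfolding poly_ring_def by auto
      then show ?thesis
        using Poly_Mapping.keys_add[of a b] ab(1) by blast
    qed
    then show ?thesis by (simp add: poly_ring_def)
  qed
  show ?thesis
  proof (rule cringI)
    show "abelian_group ?R"
    proof (rule abelian_groupI)
      show "\<exists>y\<in>carrier ?R. y \<oplus>\<^bsub>?R\<^esub> x = \<zero>\<^bsub>?R\<^esub>" if "x \<in> carrier ?R" for x
        using that by (intro bexI[of _ "- x"]) (auto simp: poly_ring_def)
      show "x \<oplus>\<^bsub>?R\<^esub> y \<in> carrier ?R" if "x \<in> carrier ?R" "y \<in> carrier ?R" for x y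
        using add_closed[OF that] by (simp add: poly_ring_def)
    qed (simp_all add: poly_ring_def add.assoc add.commute)
    show "comm_monoid ?R"
    proof (rule comm_monoidI)
      show "x \<otimes>\<^bsub>?R\<^esub> y \<in> carrier ?R" if "x \<in> carrier ?R" "y \<in> carrier ?R" for x y
        using mult_closed[OF that] by (simp add: poly_ring_def)
    qed (simp_all add: poly_ring_def mult.assoc mult.commute)
  qed (simp add: poly_ring_def distrib_right)
qed

lemma Var_in_carrier: "i \<in> {1..n} \<Longrightarrow> Var i \<in> carrier (poly_ring n)"
  by (auto simp: Var_def poly_ring_def split: if_splits)

lemma ideal_edge_ideal:
  assumes "E \<subseteq> vertex_pairs n"
  shows "ideal (edge_ideal n E :: 'k::field mpoly set) (poly_ring n)"
proof -
  interpret cring "poly_ring n :: 'k mpoly ring" by (rule cring_poly_ring)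
  have "Var i * Var j \<in> carrier (poly_ring n :: 'k mpoly ring)" if "{i, j} \<in> E" for i j
  proof -
    have "{i, j} \<subseteq> {1..n}"
    proof -
      have "{i, j} \<in> vertex_pairs n"
        using assms that by (rule subsetD)
      then obtain k l where kl: "{i, j} = {k, l}" "1 \<le> k" "k < l" "l \<le> n"
        unfolding vertex_pairs_def mem_Collect_eq by (elim exE conjE)
      have "{k, l} \<subseteq> {1..n}" using kl by simp
      then show ?thesis using kl(1) by simp
    qed
    then have "i \<in> {1..n}" "j \<in> {1..n}" by auto
    then have "Var i \<otimes>\<^bsub>poly_ring n\<^esub> Var j \<in> carrier (poly_ring n :: 'k mpoly ring)"
      by (intro m_closed Var_in_carrier)
    then show ?thesis by (simp add: poly_ring_def)
  qed
  then show ?thesis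
    unfolding edge_ideal_def by (intro genideal_ideal) auto
qed

lemma cring_edge_ring:
  assumes "E \<subseteq> vertex_pairs n"
  shows "cring (edge_ring n E :: 'k::field mpoly set ring)"
  unfolding edge_ring_def
  by (rule ideal.quotient_is_cring[OF ideal_edge_ideal[OF assms] cring_poly_ring])

end

theory Submission
  imports Defs "HOL-Real_Asymp.Real_Asymp"
begin

text \<open>A graph with a maximal independent set \<open>A\<close> and an independent set \<open>B\<close> such that
  \<open>|A| < |B|\<close> is not Cohen--Macaulay: \<open>B\<close> gives a chain of \<open>|B|\<close> strict inclusions of primes, and
  \<open>|A|\<close> bounds the depth, because the edge ring contains a copy of the polynomial ring in \<open>|A|\<close>
  variables, namely the ideal generated by the monomial \<open>x\<^sub>A\<close>.

  In a random graph let \<open>j\<close> be about \<open>3/2 log\<^sub>b n\<close> with \<open>b = 1 / (1 - p)\<close>. The greedy maximal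
  independent set has more than \<open>j\<close> elements with probability at most \<open>n (1 - p)\<^sup>j\<close>, and since
  \<open>j + 1\<close> stays well below \<open>2 log\<^sub>b n\<close>, the second moment method gives an independent set of size
  \<open>j + 1\<close> with high probability.\<close>

section \<open>Regular sequences\<close>

text \<open>The depth bound is an elementary substitute for depth S <= dim S/P, where P is the
  associated prime annihilating \<open>x_A\<close>. A polynomial relation among the elements of a
  regular sequence is needed only modulo P, since multiplication by \<open>x_A\<close> turns it into
  a relation in S. The obstacle is that \<open>x_A\<close> may itself lie in the ideal generated by
  the sequence, and then such a relation contradicts nothing. Raising every element to the power |A|
  + 1 removes the obstacle: powers of a regular sequence remain regular, and as the elements have no
  constant term, their powers live in degrees above |A|, the degree of \<open>x_A\<close>. With more
  than |A| elements, the power products with bounded exponents outnumber the monomials available in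
  S/P, which forces a forbidden relation.

  On the random side every size c log_b n with 1 < c < 2 would do: the bound for the greedy set is
  of order n^(1 - c), and the second moment error for an independent set of that size is of order
  n^(c/2 - 1) log^2 n. The value c = 3/2 gives n^(-1/2) and n^(-1/4) log^2 n.\<close>

definition ring_ideal :: "'a::comm_ring_1 set \<Rightarrow> bool" where
  "ring_ideal I \<longleftrightarrow> 0 \<in> I \<and> (\<forall>x\<in>I. \<forall>y\<in>I. x + y \<in> I) \<and> (\<forall>x\<in>I. \<forall>c. c * x \<in> I)"

lemma ring_idealD:
  assumes "ring_ideal I"
  shows "0 \<in> I" "x \<in> I \<Longrightarrow> y \<in> I \<Longrightarrow> x + y \<in> I" "x \<in> I \<Longrightarrow> c * x \<in> I" "x \<in> I \<Longrightarrow> x * c \<in> I"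
    "x \<in> I \<Longrightarrow> - x \<in> I" "x \<in> I \<Longrightarrow> y \<in> I \<Longrightarrow> x - y \<in> I"
proof -
  show "0 \<in> I" and add: "x \<in> I \<Longrightarrow> y \<in> I \<Longrightarrow> x + y \<in> I"
    and mul: "\<And>c x. x \<in> I \<Longrightarrow> c * x \<in> I" for x y
    using assms by (auto simp: ring_ideal_def)
  show "x \<in> I \<Longrightarrow> x * c \<in> I" using mul[of x c] by (simp add: mult.commute)
  show neg: "- x \<in> I" if "x \<in> I" for x using mul[OF that, of "-1"] by simp
  show "x \<in> I \<Longrightarrow> y \<in> I \<Longrightarrow> x - y \<in> I" using add[of x "- y"] neg[of y] by simp
qed

text \<open>For an ideal \<open>I\<close> this is the ideal \<open>I + (y)\<close>; the explicit
  form reduces membership to a single equation.\<close>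

definition adjoin :: "'a::comm_ring_1 set \<Rightarrow> 'a \<Rightarrow> 'a set" where
  "adjoin I y = {a + y * c | a c. a \<in> I}"

lemma adjoinI: "a \<in> I \<Longrightarrow> a + y * c \<in> adjoin I y"
  by (auto simp: adjoin_def)

lemma adjoinE:
  assumes "x \<in> adjoin I y"
  obtains a c where "a \<in> I" "x = a + y * c"
  using assms by (auto simp: adjoin_def)

lemma adjoin_superset: "I \<subseteq> adjoin I y"
  using adjoinI[of _ I y 0] by auto

lemma ring_ideal_adjoin:
  assumes "ring_ideal I"
  shows "ring_ideal (adjoin I y)"
  unfolding ring_ideal_def
proof (intro conjI ballI allI)
  show "0 \<in> adjoin I y" using adjoinI[of 0 I y 0] ring_idealD[OF assms] by simp
next
  fix x z assume "x \<in> adjoin I y" "z \<in> adjoin I y"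
  then obtain a c a' c' where *: "a \<in> I" "x = a + y * c" "a' \<in> I" "z = a' + y * c'"
    by (auto elim!: adjoinE)
  then have "x + z = (a + a') + y * (c + c')" by (simp add: algebra_simps)
  then show "x + z \<in> adjoin I y" using * ring_idealD(2)[OF assms] adjoinI by metis
next
  fix x d assume "x \<in> adjoin I y"
  then obtain a c where *: "a \<in> I" "x = a + y * c" by (auto elim!: adjoinE)
  then have "d * x = d * a + y * (d * c)" by (simp add: algebra_simps)
  then show "d * x \<in> adjoin I y" using * ring_idealD(3)[OF assms] adjoinI by metis
qed

lemma adjoin_commute: "adjoin (adjoin I x) y = adjoin (adjoin I y) x"
proof -
  have "adjoin (adjoin I x) y \<subseteq> adjoin (adjoin I y) x" for x y :: 'a
  proof
    fix w assume "w \<in> adjoin (adjoin I x) y"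
    then obtain a c d where "a \<in> I" "w = (a + x * c) + y * d" by (auto elim!: adjoinE)
    then have "a \<in> I" "w = (a + y * d) + x * c" by (simp_all add: algebra_simps)
    then show "w \<in> adjoin (adjoin I y) x" by (metis adjoinI)
  qed
  then show ?thesis by blast
qed

abbreviation adjoins :: "'a::comm_ring_1 set \<Rightarrow> 'a list \<Rightarrow> 'a set" where
  "adjoins \<equiv> foldl adjoin"

lemma ring_ideal_adjoins: "ring_ideal I \<Longrightarrow> ring_ideal (adjoins I ys)"
  by (induction ys arbitrary: I) (simp_all add: ring_ideal_adjoin)

lemma adjoins_superset: "I \<subseteq> adjoins I ys"
proof (induction ys arbitrary: I)
  case (Cons y ys)
  show ?case using order_trans[OF adjoin_superset Cons.IH] by simp
qed simp

lemma subset_adjoins: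
  assumes "ring_ideal I"
  shows "set ys \<subseteq> adjoins I ys"
  using assms
proof (induction ys arbitrary: I)
  case (Cons y ys)
  have "0 + y * 1 \<in> adjoin I y" using Cons.prems by (intro adjoinI ring_idealD(1))
  then have "y \<in> adjoins (adjoin I y) ys" using adjoins_superset by auto
  then show ?case using Cons.IH[OF ring_ideal_adjoin[OF Cons.prems]] by simp
qed simp

lemma adjoins_minimal:
  assumes "ring_ideal K" "I \<subseteq> K" "set ys \<subseteq> K"
  shows "adjoins I ys \<subseteq> K"
  using assms(2,3)
proof (induction ys arbitrary: I)
  case (Cons y ys)
  have "adjoin I y \<subseteq> K"
    using Cons.prems ring_idealD(2,4)[OF assms(1)] by (auto elim!: adjoinE)
  then show ?case using Cons.IH Cons.prems(2) by simp
qed simp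

text \<open>\<open>regular_on I ys\<close>: the sequence \<open>ys\<close> is regular on the quotient by \<open>I\<close>, except that the
  final quotient may be zero.\<close>

fun regular_on :: "'a::comm_ring_1 set \<Rightarrow> 'a list \<Rightarrow> bool" where
  "regular_on I [] \<longleftrightarrow> True"
| "regular_on I (y # ys) \<longleftrightarrow> (\<forall>a. y * a \<in> I \<longrightarrow> a \<in> I) \<and> regular_on (adjoin I y) ys"

lemma regular_on_ConsD:
  assumes "regular_on I (y # ys)"
  shows "y * a \<in> I \<Longrightarrow> a \<in> I" and "regular_on (adjoin I y) ys"
  using assms unfolding regular_on.simps by blast+

lemma regular_on_ConsI:
  assumes "\<And>a. y * a \<in> I \<Longrightarrow> a \<in> I" and "regular_on (adjoin I y) ys"
  shows "regular_on I (y # ys)"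
  using assms unfolding regular_on.simps by blast

text \<open>The recursive form suits inductions over the sequence; the indexed form matches
  \<open>regular_sequence\<close>.\<close>

lemma regular_on_conv_nth:
  "regular_on I ys \<longleftrightarrow>
     (\<forall>i<length ys. \<forall>a. ys ! i * a \<in> adjoins I (take i ys) \<longrightarrow> a \<in> adjoins I (take i ys))"
proof (induction ys arbitrary: I)
  case (Cons y ys)
  show ?case
    unfolding regular_on.simps Cons length_Cons All_less_Suc2 by simp
qed simp

text \<open>The hypotheses say that multiplication by \<open>a\<close> induces a short exact sequence
  \<open>0 \<rightarrow> R/I\<^sub>1 \<rightarrow> R/I\<^sub>2 \<rightarrow> R/I\<^sub>3 \<rightarrow> 0\<close>; regularity on the outer terms keeps
  it exact modulo the elements of the sequence.\<close>

lemma regular_on_extension: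
  assumes "regular_on I1 ys" "regular_on I3 ys" "ring_ideal I1" "ring_ideal I2"
    and "\<And>x. a * x \<in> I2 \<longleftrightarrow> x \<in> I1" and "I3 = adjoin I2 a"
  shows "regular_on I2 ys"
  using assms
proof (induction ys arbitrary: I1 I2 I3)
  case (Cons y ys)
  note I1 = ring_idealD[OF Cons.prems(3)] and I2 = ring_idealD[OF Cons.prems(4)]
  note ax = Cons.prems(5) and I3 = Cons.prems(6)
  note nzd1 = regular_on_ConsD(1)[OF Cons.prems(1)] and nzd3 = regular_on_ConsD(1)[OF Cons.prems(2)]
  \<comment> \<open>\<open>y\<close> is a nonzerodivisor on the middle term: \<open>w\<close>
    vanishes in the right-hand quotient, hence comes from some \<open>s\<close> in the left-hand
    one, where \<open>y\<close> can be cancelled.\<close>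
  have "w \<in> I2" if w: "y * w \<in> I2" for w
  proof -
    have "y * w \<in> I3" using w adjoin_superset[of I2 a] unfolding I3 by blast
    then have "w \<in> I3" by (rule nzd3)
    then obtain i s where is': "i \<in> I2" "w = i + a * s" unfolding I3 by (rule adjoinE)
    have ys: "y * i \<in> I2" using is'(1) by (rule I2(3))
    have "a * (y * s) = y * w - y * i" using is' by (simp add: algebra_simps)
    also have "\<dots> \<in> I2" using w ys by (rule I2(6))
    finally have "y * s \<in> I1" by (simp only: ax)
    then have "a * s \<in> I2" using nzd1 by (simp only: ax)
    then show ?thesis unfolding is'(2) by (rule I2(2)[OF is'(1)])
  qed
  moreover have "regular_on (adjoin I2 y) ys"
  proof (rule Cons.IH)
    show "regular_on (adjoin I1 y) ys" "regular_on (adjoin I3 y) ys"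
      using Cons.prems(1,2) by (blast dest: regular_on_ConsD(2))+
    show "ring_ideal (adjoin I1 y)" "ring_ideal (adjoin I2 y)"
      using Cons.prems(3,4) by (simp_all add: ring_ideal_adjoin)
    show "adjoin I3 y = adjoin (adjoin I2 y) a"
      unfolding I3 by (rule adjoin_commute)
    \<comment> \<open>Multiplication by \<open>a\<close> stays injective modulo \<open>y\<close>: in
      \<open>a * x = i + y * w\<close> the factor \<open>w\<close> vanishes in the right-hand
      quotient, because \<open>y\<close> is a nonzerodivisor there, so \<open>y * w\<close> is up to
      \<open>I2\<close> the image of some \<open>y * s\<close>.\<close>
    show "a * x \<in> adjoin I2 y \<longleftrightarrow> x \<in> adjoin I1 y" for x
    proof
      assume "a * x \<in> adjoin I2 y"
      then obtain i w where iw: "i \<in> I2" "a * x = i + y * w" by (rule adjoinE)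
      have "y * w = - i + a * x" using iw(2) by simp
      then have "y * w \<in> I3" unfolding I3 using adjoinI[OF I2(5)[OF iw(1)]] by simp
      then have "w \<in> adjoin I2 a" using nzd3 unfolding I3 by blast
      then obtain i' s where is': "i' \<in> I2" "w = i' + a * s" by (rule adjoinE)
      have "a * (x - y * s) = i + y * i'" using iw is' by (simp add: algebra_simps)
      also have "\<dots> \<in> I2" using I2(2)[OF iw(1) I2(3)[OF is'(1)]] .
      finally have "x - y * s \<in> I1" by (simp only: ax)
      then have "(x - y * s) + y * s \<in> adjoin I1 y" by (rule adjoinI)
      then show "x \<in> adjoin I1 y" by simp
    next
      assume "x \<in> adjoin I1 y"
      then obtain i w where iw: "i \<in> I1" "x = i + y * w" by (rule adjoinE)
      have "a * x = a * i + y * (a * w)" using iw(2) by (simp add: algebra_simps)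
      also have "\<dots> \<in> adjoin I2 y" using iw(1) by (intro adjoinI) (simp only: ax)
      finally show "a * x \<in> adjoin I2 y" .
    qed
  qed
  ultimately show ?case by (rule regular_on_ConsI)
qed simp

text \<open>As \<open>a\<close> is a nonzerodivisor modulo \<open>I\<close>, multiplication by
  \<open>a\<close> gives a short exact sequence from \<open>R/(I + b)\<close> through
  \<open>R/(I + ab)\<close> to \<open>R/(I + a)\<close>, and \<open>regular_on_extension\<close>
  applies to the tail \<open>ys\<close>.\<close>

lemma regular_on_mult:
  assumes I: "ring_ideal I" and a: "regular_on I (a # ys)" and b: "regular_on I (b # ys)"
  shows "regular_on I (a * b # ys)"
proof -
  note D = ring_idealD[OF I]
  note nzd = regular_on_ConsD(1)[OF a] regular_on_ConsD(1)[OF b]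
  have "regular_on (adjoin I (a * b)) ys"
  proof (rule regular_on_extension)
    show "regular_on (adjoin I b) ys" "regular_on (adjoin I a) ys"
      using a b by (blast dest: regular_on_ConsD(2))+
    show "ring_ideal (adjoin I b)" "ring_ideal (adjoin I (a * b))"
      using I by (simp_all add: ring_ideal_adjoin)
    show "a * x \<in> adjoin I (a * b) \<longleftrightarrow> x \<in> adjoin I b" for x
    proof
      assume "a * x \<in> adjoin I (a * b)"
      then obtain i r where ir: "i \<in> I" "a * x = i + a * b * r" by (rule adjoinE)
      then have "a * (x - b * r) = i" by (simp add: algebra_simps)
      then have "x - b * r \<in> I" using ir(1) nzd by blast
      then have "(x - b * r) + b * r \<in> adjoin I b" by (rule adjoinI)
      then show "x \<in> adjoin I b" by simp
    next
      assume "x \<in> adjoin I b"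
      then obtain i r where ir: "i \<in> I" "x = i + b * r" by (rule adjoinE)
      have "a * x = a * i + a * b * r" using ir(2) by (simp add: algebra_simps)
      also have "\<dots> \<in> adjoin I (a * b)" by (intro adjoinI D(3) ir(1))
      finally show "a * x \<in> adjoin I (a * b)" .
    qed
    show "adjoin I a = adjoin (adjoin I (a * b)) a"
    proof
      show "adjoin I a \<subseteq> adjoin (adjoin I (a * b)) a"
        using adjoin_superset[of I "a * b"] by (auto simp: adjoin_def)
      show "adjoin (adjoin I (a * b)) a \<subseteq> adjoin I a"
      proof
        fix w assume "w \<in> adjoin (adjoin I (a * b)) a"
        then obtain i c d where "i \<in> I" "w = (i + a * b * c) + a * d" by (auto elim!: adjoinE)
        then have "i \<in> I" "w = i + a * (b * c + d)" by (simp_all add: algebra_simps)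
        then show "w \<in> adjoin I a" by (metis adjoinI)
      qed
    qed
  qed
  moreover have "x \<in> I" if "a * b * x \<in> I" for x
    using that nzd unfolding mult.assoc by blast
  ultimately show ?thesis by (rule regular_on_ConsI[rotated])
qed

lemma regular_on_map_power:
  assumes "ring_ideal I" "regular_on I ys" "0 < m"
  shows "regular_on I (map (\<lambda>y. y ^ m) ys)"
  using assms
proof (induction ys arbitrary: I)
  case (Cons y ys)
  \<comment> \<open>Only the head is raised to a power here; the powers in the tail come from the
    induction hypothesis over the ideal \<open>adjoin I (y ^ m)\<close>.\<close>
  have "regular_on I (y ^ Suc k # ys)" for k
  proof (induction k)
    case 0
    then show ?case using Cons.prems(2) by (simp only: power_Suc power_0 mult_1_right)
  next
    case (Suc k)
    show ?case
      using regular_on_mult[OF Cons.prems(1,2) Suc.IH] by (simp only: power_Suc)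
  qed
  from this[of "m - 1"] have *: "regular_on I (y ^ m # ys)" using Cons.prems(3) by simp
  have "regular_on (adjoin I (y ^ m)) (map (\<lambda>y. y ^ m) ys)"
    using Cons.prems regular_on_ConsD(2)[OF *] by (intro Cons.IH ring_ideal_adjoin)
  with regular_on_ConsD(1)[OF *] show ?case unfolding list.map by (rule regular_on_ConsI)
qed simp

section \<open>Power products of a regular sequence and their algebraic independence\<close>

definition exponents :: "nat \<Rightarrow> nat \<Rightarrow> nat list set" where
  "exponents r d = {e. set e \<subseteq> {..<r} \<and> length e = d}"

lemma finite_exponents: "finite (exponents r d)"
  unfolding exponents_def by (rule finite_lists_length_eq) simp

lemma card_exponents: "card (exponents r d) = r ^ d"
  unfolding exponents_def by (subst card_lists_length_eq) simp_all

lemma sum_exponents_Suc: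
  "(\<Sum>e\<in>exponents r (Suc d). f e) = (\<Sum>i<r. \<Sum>e\<in>exponents r d. f (i # e))"
proof -
  have eq: "exponents r (Suc d) = (\<lambda>(i, e). i # e) ` ({..<r} \<times> exponents r d)"
    by (auto simp: exponents_def image_iff length_Suc_conv)
  show ?thesis
    unfolding eq
    by (subst sum.reindex) (auto simp: inj_on_def sum.cartesian_product case_prod_unfold)
qed

definition power_product :: "'a::comm_ring_1 list \<Rightarrow> nat list \<Rightarrow> 'a" where
  "power_product zs e = (\<Prod>i<length zs. zs ! i ^ (e ! i))"

lemma power_product_Cons: "power_product (z # zs) (k # e) = z ^ k * power_product zs e"
  unfolding power_product_def length_Cons by (subst prod.lessThan_Suc_shift) simp

lemma regular_on_power_cancel:
  assumes "regular_on I (z # zs)" "z ^ k * x \<in> I"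
  shows "x \<in> I"
  using assms(2)
proof (induction k)
  case (Suc k)
  have "z * (z ^ k * x) \<in> I" using Suc.prems by (simp only: power_Suc mult.assoc)
  from regular_on_ConsD(1)[OF assms(1) this] show ?case by (rule Suc.IH)
qed simp

text \<open>A regular sequence is algebraically independent over a field of scalars, even after
  multiplication by any element outside the ideal that it generates: cancel the lowest power of
  the first element, and reduce modulo that element.\<close>

lemma regular_on_independent:
  fixes s :: "'k::field \<Rightarrow> 'a::comm_ring_1"
  assumes "\<And>a b. s (a * b) = s a * s b" "s 1 = 1" "s 0 = 0"
    and "ring_ideal I" "regular_on I zs" "u \<notin> adjoins I zs"
    and "(\<Sum>e\<in>exponents r (length zs). s (c e) * power_product zs e) * u \<in> I"
    and "e \<in> exponents r (length zs)"
  shows "c e = 0"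
  using assms(4-)
proof (induction zs arbitrary: I c e)
  case Nil
  have "exponents r 0 = {[]}" by (auto simp: exponents_def)
  then have *: "s (c []) * u \<in> I" "e = []" using Nil by (auto simp: power_product_def)
  show ?case
  proof (rule ccontr)
    assume "c e \<noteq> 0"
    then have "s (inverse (c [])) * (s (c []) * u) = u"
      using * assms(1)[of "inverse (c [])" "c []"] assms(2) by (simp add: mult.assoc[symmetric])
    then show False using * ring_idealD(3)[OF Nil.prems(1)] Nil.prems(3) by (metis foldl_Nil)
  qed
next
  case (Cons z zs)
  define q where "q i = (\<Sum>e\<in>exponents r (length zs). s (c (i # e)) * power_product zs e)" for i
  have sum_eq: "(\<Sum>e\<in>exponents r (length (z # zs)). s (c e) * power_product (z # zs) e)
      = (\<Sum>i<r. z ^ i * q i)"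
    by (simp add: sum_exponents_Suc power_product_Cons q_def sum_distrib_left mult_ac)
  have "\<forall>e\<in>exponents r (length zs). c (i # e) = 0" if "i < r" for i
    using that
  proof (induction i rule: less_induct)
    case (less i)
    have q0: "q k = 0" if "k < i" for k
      unfolding q_def using less.IH[OF that] that less.prems by (simp add: assms(3))
    \<comment> \<open>The terms above index \<open>i\<close> are multiples of
      \<open>z ^ Suc i\<close>. Once \<open>z ^ i\<close> is cancelled they vanish modulo
      \<open>z\<close>, and what remains is a relation with coefficients \<open>c (i # e)\<close>
      among \<open>zs\<close> modulo \<open>adjoin I z\<close>.\<close>
    have "z ^ Suc i dvd (\<Sum>k\<in>{Suc i..<r}. z ^ k * q k)"
      by (intro dvd_sum dvd_mult2 le_imp_power_dvd) auto
    then obtain t where t: "(\<Sum>k\<in>{Suc i..<r}. z ^ k * q k) = z ^ i * (z * t)"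
      by (auto simp: dvd_def mult_ac)
    have split: "{..<r} = insert i ({..<i} \<union> {Suc i..<r})" using less.prems by auto
    have "(\<Sum>k<r. z ^ k * q k)
        = (\<Sum>k<i. z ^ k * q k) + z ^ i * q i + (\<Sum>k\<in>{Suc i..<r}. z ^ k * q k)"
      unfolding split by (subst sum.insert, simp, simp, subst sum.union_disjoint) (auto simp: add_ac)
    also have "(\<Sum>k<i. z ^ k * q k) = 0" using q0 by simp
    finally have "(\<Sum>k<r. z ^ k * q k) = z ^ i * (q i + z * t)"
      unfolding t by (simp add: algebra_simps)
    then have "z ^ i * ((q i + z * t) * u) \<in> I"
      using Cons.prems(4) unfolding sum_eq by (simp add: mult.assoc)
    then have "(q i + z * t) * u \<in> I" by (rule regular_on_power_cancel[OF Cons.prems(2)])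
    then have "(q i + z * t) * u + z * (- t * u) \<in> adjoin I z" by (rule adjoinI)
    then have "q i * u \<in> adjoin I z" by (simp add: algebra_simps)
    then have "c (i # e) = 0" if "e \<in> exponents r (length zs)" for e
      using Cons.prems(1,3) regular_on_ConsD(2)[OF Cons.prems(2)] that unfolding q_def
      by (intro Cons.IH[of "adjoin I z" "\<lambda>e. c (i # e)" e]) (simp_all add: ring_ideal_adjoin)
    then show ?case by blast
  qed
  then show ?case using Cons.prems(5)
    by (auto simp: exponents_def length_Suc_conv)
qed

text \<open>Gaussian elimination by induction on the set \<open>Y\<close> of equations: an unknown
  \<open>x0\<close> with nonzero coefficient at \<open>y\<close> is eliminated from the other
  equations, and its value \<open>c0\<close> is read off from equation \<open>y\<close> at the
  end.\<close>

lemma homogeneous_system_nontrivial_solution: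
  fixes M :: "'x \<Rightarrow> 'y \<Rightarrow> 'k::field"
  assumes "finite Y" "finite X" "card Y < card X"
  shows "\<exists>c. (\<exists>x\<in>X. c x \<noteq> 0) \<and> (\<forall>y\<in>Y. (\<Sum>x\<in>X. c x * M x y) = 0)"
  using assms
proof (induction Y arbitrary: X M rule: finite_induct)
  case empty
  then obtain x where "x \<in> X" by fastforce
  then show ?case by (intro exI[of _ "\<lambda>_. 1"]) auto
next
  case (insert y Y)
  show ?case
  proof (cases "\<forall>x\<in>X. M x y = 0")
    case True
    have "card Y < card X" using insert by simp
    then obtain c where "\<exists>x\<in>X. c x \<noteq> 0" "\<forall>y\<in>Y. (\<Sum>x\<in>X. c x * M x y) = 0"
      using insert.IH[of X M] insert.prems by blast
    then show ?thesis using True by (intro exI[of _ c]) auto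
  next
    case False
    then obtain x0 where x0: "x0 \<in> X" "M x0 y \<noteq> 0" by blast
    define X' where "X' = X - {x0}"
    have X': "finite X'" "card Y < card X'" "x0 \<notin> X'" "X = insert x0 X'"
      using insert.prems insert.hyps x0 by (auto simp: X'_def)
    obtain c where c: "\<exists>x\<in>X'. c x \<noteq> 0"
        "\<forall>z\<in>Y. (\<Sum>x\<in>X'. c x * (M x z - M x y / M x0 y * M x0 z)) = 0"
      using insert.IH[OF X'(1,2), of "\<lambda>x z. M x z - M x y / M x0 y * M x0 z"] by blast
    define c0 where "c0 = - (\<Sum>x\<in>X'. c x * (M x y / M x0 y))"
    define c' where "c' = c(x0 := c0)"
    have sum_c': "(\<Sum>x\<in>X. c' x * M x z) = c0 * M x0 z + (\<Sum>x\<in>X'. c x * M x z)" for z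
    proof -
      have "(\<Sum>x\<in>X'. c' x * M x z) = (\<Sum>x\<in>X'. c x * M x z)"
        using X'(3) by (intro sum.cong) (auto simp: c'_def)
      then show ?thesis using X' by (simp add: c'_def)
    qed
    have "(\<Sum>x\<in>X. c' x * M x y) = 0"
      unfolding sum_c' c0_def using x0 by (simp add: sum_distrib_right)
    moreover have "(\<Sum>x\<in>X. c' x * M x z) = 0" if "z \<in> Y" for z
      using c(2) that unfolding sum_c' c0_def
      by (simp add: sum_distrib_right sum_subtractf right_diff_distrib mult.assoc)
    moreover have "\<exists>x\<in>X. c' x \<noteq> 0" using c(1) X' by (auto simp: c'_def)
    ultimately show ?thesis by (intro exI[of _ c']) auto
  qed
qed


section \<open>Depth and dimension of edge rings\<close>

abbreviation keys where "keys \<equiv> Poly_Mapping.keys"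
abbreviation lookup where "lookup \<equiv> Poly_Mapping.lookup"

lemma keys_mult_subset:
  assumes "keys f \<subseteq> A" "keys g \<subseteq> B" "\<And>a b. a \<in> A \<Longrightarrow> b \<in> B \<Longrightarrow> a + b \<in> C"
  shows "keys (f * g) \<subseteq> C"
  using Poly_Mapping.keys_mult[of f g] assms by blast

lemma poly_mapping_sum_single: "(\<Sum>m\<in>keys f. Poly_Mapping.single m (lookup f m)) = f"
  by (rule poly_mapping_eqI)
    (auto simp: lookup_sum lookup_single when_def not_in_keys_iff_lookup_eq_zero if_distrib
      cong: if_cong)

lemma poly_mapping_nat_add_eq_0_iff: "a + b = (0 :: 'x \<Rightarrow>\<^sub>0 nat) \<longleftrightarrow> a = 0 \<and> b = 0"
  by (auto simp: poly_mapping_eq_iff fun_eq_iff lookup_add)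

lemma keys_add_nat: "keys (a + b :: 'x \<Rightarrow>\<^sub>0 nat) = keys a \<union> keys b"
  by (auto simp: in_keys_iff lookup_add)

definition filter_keys :: "('m \<Rightarrow> bool) \<Rightarrow> ('m \<Rightarrow>\<^sub>0 'k::comm_monoid_add) \<Rightarrow> 'm \<Rightarrow>\<^sub>0 'k" where
  "filter_keys P f = (\<Sum>m | m \<in> keys f \<and> P m. Poly_Mapping.single m (lookup f m))"

lemma lookup_filter_keys: "lookup (filter_keys P f) m = (if P m then lookup f m else 0)"
  by (auto simp: filter_keys_def lookup_sum lookup_single when_def in_keys_iff if_distrib
      cong: if_cong)

lemma keys_filter_keys: "keys (filter_keys P f) = {m \<in> keys f. P m}"
  by (auto simp: in_keys_iff lookup_filter_keys split: if_splits)

lemma keys_minus_filter_keys: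
  "keys (f - filter_keys P f :: 'm \<Rightarrow>\<^sub>0 'k::ab_group_add) = {m \<in> keys f. \<not> P m}"
  by (auto simp: in_keys_iff lookup_filter_keys lookup_minus split: if_splits)

text \<open>Monomial ideals: \<open>N\<close> is a set of exponent vectors closed under multiples.
  \<open>full_ideal\<close> and the auxiliary ideals of the depth and dimension bounds have this
  form, so membership in them is a condition on supports.\<close>

lemma ring_ideal_keys:
  fixes N :: "(nat \<Rightarrow>\<^sub>0 nat) set"
  assumes "\<And>a b. b \<in> N \<Longrightarrow> a + b \<in> N"
  shows "ring_ideal {f :: 'k::field mpoly. keys f \<subseteq> N}"
  unfolding ring_ideal_def
proof (intro conjI ballI allI)
  show "f + g \<in> {f. keys f \<subseteq> N}" if "f \<in> {f. keys f \<subseteq> N}" "g \<in> {f. keys f \<subseteq> N}" for f g :: "'k mpoly"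
    using that Poly_Mapping.keys_add[of f g] by auto
  show "c * f \<in> {f. keys f \<subseteq> N}" if "f \<in> {f. keys f \<subseteq> N}" for c f :: "'k mpoly"
    using that assms keys_mult_subset[of c UNIV f N N] by simp
qed simp

lemma vertex_pairsD:
  assumes "E \<subseteq> vertex_pairs n" "{i, j} \<in> E"
  shows "i \<in> {1..n}" "j \<in> {1..n}" "i \<noteq> j"
proof -
  have "{i, j} \<in> vertex_pairs n" using assms by blast
  then show "i \<in> {1..n}" "j \<in> {1..n}" "i \<noteq> j"
    by (auto simp: vertex_pairs_def doubleton_eq_iff)
qed

definition independent_set :: "nat \<Rightarrow> nat set set \<Rightarrow> nat set \<Rightarrow> bool" where
  "independent_set n E S \<longleftrightarrow> S \<subseteq> {1..n} \<and> (\<forall>i\<in>S. \<forall>j\<in>S. {i, j} \<notin> E)"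

lemma independent_set_subset: "independent_set n E S \<Longrightarrow> T \<subseteq> S \<Longrightarrow> independent_set n E T"
  by (auto simp: independent_set_def)

text \<open>The edge ideal, enlarged by the variables other than \<open>1, \<dots>, n\<close>: the full polynomial ring
  modulo this ideal is the edge ring, which avoids explicit carriers.\<close>

definition full_ideal :: "nat \<Rightarrow> nat set set \<Rightarrow> 'k::field mpoly set" where
  "full_ideal n E = {f. keys f \<subseteq> {m. \<not> independent_set n E (keys m)}}"

lemma ring_ideal_full_ideal: "ring_ideal (full_ideal n E)"
  unfolding full_ideal_def
  by (rule ring_ideal_keys) (auto simp: keys_add_nat dest: independent_set_subset)

lemma lookup_scalar_mult: "lookup (Poly_Mapping.single 0 c * f :: 'k::field mpoly) m = c * lookup f m"
  unfolding mult_map_scale_conv_mult[symmetric] by (simp add: map.rep_eq when_def)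

text \<open>\<open>J\<close> is generated by the variables outside \<open>T\<close>. Deleting the
  monomials in \<open>J\<close> from \<open>f\<close> and \<open>g\<close> changes the product only
  by an element of \<open>J\<close>; the product of the rest involves only variables from
  \<open>T\<close>, so it lies in \<open>J\<close> only if it is zero, and the polynomial ring is a
  domain.\<close>

lemma prime_no_keys:
  fixes f g :: "'k::field mpoly" and T :: "nat set"
  defines "J \<equiv> {f :: 'k mpoly. keys f \<subseteq> {m. \<not> keys m \<subseteq> T}}"
  assumes "f * g \<in> J"
  shows "f \<in> J \<or> g \<in> J"
proof (rule ccontr)
  assume neg: "\<not> (f \<in> J \<or> g \<in> J)"
  let ?f = "filter_keys (\<lambda>m. keys m \<subseteq> T) f" and ?g = "filter_keys (\<lambda>m. keys m \<subseteq> T) g"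
  have J: "ring_ideal J" unfolding J_def by (rule ring_ideal_keys) (auto simp: keys_add_nat)
  note D = ring_idealD[OF J]
  have rest: "f - ?f \<in> J" "g - ?g \<in> J" by (auto simp: J_def keys_minus_filter_keys)
  have "f * g - (f - ?f) * g - ?f * (g - ?g) \<in> J"
    by (rule D(6)[OF D(6)[OF assms(2) D(4)[OF rest(1)]] D(3)[OF rest(2)]])
  then have "?f * ?g \<in> J" by (simp add: algebra_simps)
  moreover have "keys (?f * ?g) \<subseteq> {m. keys m \<subseteq> T}"
    by (rule keys_mult_subset[of _ "{m. keys m \<subseteq> T}" _ "{m. keys m \<subseteq> T}"])
      (auto simp: keys_filter_keys keys_add_nat)
  ultimately have "keys (?f * ?g) = {}" unfolding J_def by blast
  then have "?f * ?g = 0" by simp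
  moreover have "?f \<noteq> 0" "?g \<noteq> 0"
    using neg unfolding J_def keys_eq_empty[symmetric] keys_filter_keys by blast+
  ultimately show False by simp
qed

section \<open>Degrees, exponent bounds and counting of monomials\<close>

definition total_degree :: "(nat \<Rightarrow>\<^sub>0 nat) \<Rightarrow> nat" where
  "total_degree m = (\<Sum>v\<in>keys m. lookup m v)"

lemma total_degree_superset: "finite S \<Longrightarrow> keys m \<subseteq> S \<Longrightarrow> total_degree m = (\<Sum>v\<in>S. lookup m v)"
  unfolding total_degree_def by (rule sum.mono_neutral_left) (auto simp: in_keys_iff)

lemma total_degree_add: "total_degree (a + b) = total_degree a + total_degree b"
  using total_degree_superset[of "keys a \<union> keys b" a] total_degree_superset[of "keys a \<union> keys b" b]
    total_degree_superset[of "keys a \<union> keys b" "a + b"]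
  by (simp add: keys_add_nat lookup_add sum.distrib)

lemma total_degree_pos: "m \<noteq> 0 \<Longrightarrow> 0 < total_degree m"
  by (auto simp: total_degree_def in_keys_iff intro!: sum_pos)

lemma keys_power_total_degree:
  fixes f :: "'k::field mpoly"
  assumes "0 \<notin> keys f"
  shows "keys (f ^ k) \<subseteq> {m. k \<le> total_degree m}"
proof (induction k)
  case (Suc k)
  have "keys f \<subseteq> {m. 1 \<le> total_degree m}"
    using assms by (auto simp: Suc_le_eq intro!: total_degree_pos)
  then show ?case unfolding power_Suc
    by (rule keys_mult_subset[OF _ Suc.IH]) (auto simp: total_degree_add)
qed simp

text \<open>Each exponent is bounded separately, because the monomials in the variables from a
  finite set \<open>A\<close> then embed into a box with \<open>(N + 1) ^ card A\<close>
  points.\<close>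

definition exponent_bound :: "nat \<Rightarrow> 'k::field mpoly \<Rightarrow> bool" where
  "exponent_bound N f \<longleftrightarrow> keys f \<subseteq> {m. \<forall>v. lookup m v \<le> N}"

lemma exponent_bound_mult: "exponent_bound N f \<Longrightarrow> exponent_bound M g \<Longrightarrow> exponent_bound (N + M) (f * g)"
  unfolding exponent_bound_def by (erule keys_mult_subset) (auto simp: lookup_add intro: add_mono)

lemma exponent_bound_mono:
  assumes "exponent_bound N f" "N \<le> M"
  shows "exponent_bound M f"
proof -
  have "{m. \<forall>v. lookup m v \<le> N} \<subseteq> {m. \<forall>v. lookup m v \<le> M}"
    using assms(2) le_trans by blast
  then show ?thesis using assms(1) unfolding exponent_bound_def by (rule subset_trans[rotated])
qed

lemma exponent_bound_power: "exponent_bound N f \<Longrightarrow> exponent_bound (k * N) (f ^ k)"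
  by (induction k) (simp_all add: exponent_bound_mult, simp add: exponent_bound_def)

lemma exponent_bound_prod:
  "(\<And>i. i < k \<Longrightarrow> exponent_bound N (f i)) \<Longrightarrow> exponent_bound (k * N) (\<Prod>i<k. f i)"
proof (induction k)
  case (Suc k)
  then show ?case using exponent_bound_mult[of "k * N" "\<Prod>i<k. f i" N "f k"]
    by (simp add: add.commute)
qed (simp add: exponent_bound_def)

lemma ex_exponent_bound: "\<exists>N. exponent_bound N f"
proof -
  define N where "N = (\<Sum>m\<in>keys f. total_degree m)"
  have "lookup m v \<le> N" if "m \<in> keys f" for m v
  proof -
    have "lookup m v \<le> total_degree m"
    proof (cases "v \<in> keys m")
      case True
      then show ?thesis unfolding total_degree_def by (intro member_le_sum) auto
    qed (simp add: in_keys_iff)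
    also have "\<dots> \<le> N" unfolding N_def using that by (intro member_le_sum) auto
    finally show ?thesis .
  qed
  then show ?thesis unfolding exponent_bound_def by blast
qed

lemma ex_exponent_bound_list: "\<exists>N. \<forall>f\<in>set fs. exponent_bound N f"
proof (induction fs)
  case (Cons f fs)
  then obtain N M where "\<forall>f\<in>set fs. exponent_bound N f" "exponent_bound M f"
    using ex_exponent_bound by blast
  then have "\<forall>g\<in>set (f # fs). exponent_bound (N + M) g"
    by (auto intro: exponent_bound_mono)
  then show ?case by blast
qed simp

lemma exponent_bound_power_product:
  assumes "\<forall>f\<in>set zs. exponent_bound N f" "e \<in> exponents r (length zs)"
  shows "exponent_bound (length zs * (r * N)) (power_product zs e)"
  unfolding power_product_def
proof (rule exponent_bound_prod)
  fix i assume i: "i < length zs"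
  then have "e ! i < r" using assms(2) nth_mem[of i e]
    by (auto simp: exponents_def subset_iff simp del: nth_mem)
  have "exponent_bound (e ! i * N) (zs ! i ^ (e ! i))"
    using assms(1) i by (intro exponent_bound_power) auto
  then show "exponent_bound (r * N) (zs ! i ^ (e ! i))"
    using \<open>e ! i < r\<close> by (elim exponent_bound_mono) simp
qed

lemma bounded_monomials:
  fixes A :: "nat set" and N :: nat
  assumes "finite A"
  defines "Y \<equiv> {m :: nat \<Rightarrow>\<^sub>0 nat. keys m \<subseteq> A \<and> (\<forall>v. lookup m v \<le> N)}"
  shows "finite Y" "card Y \<le> (N + 1) ^ card A"
proof -
  have fin: "finite (A \<rightarrow>\<^sub>E {..N})" using assms by (intro finite_PiE) auto
  have "inj_on (\<lambda>m. restrict (lookup m) A) Y"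
  proof (rule inj_onI, rule poly_mapping_eqI)
    fix m m' v assume m: "m \<in> Y" "m' \<in> Y" "restrict (lookup m) A = restrict (lookup m') A"
    show "lookup m v = lookup m' v"
    proof (cases "v \<in> A")
      case True
      then show ?thesis using fun_cong[OF m(3), of v] by simp
    next
      case False
      then have "v \<notin> keys m" "v \<notin> keys m'" using m(1,2) by (auto simp: Y_def)
      then show ?thesis by (simp add: in_keys_iff)
    qed
  qed
  moreover have "(\<lambda>m. restrict (lookup m) A) ` Y \<subseteq> A \<rightarrow>\<^sub>E {..N}"
    by (auto simp: Y_def)
  ultimately show "finite Y" "card Y \<le> (N + 1) ^ card A"
    using inj_on_finite[OF _ _ fin] card_inj_on_le[OF _ _ fin] assms(1)
    by (auto simp: card_PiE)
qed

text \<open>Maximality is encoded as domination: this is what makes \<open>x_v x_A\<close> zero in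
  the edge ring for every vertex \<open>v\<close> outside \<open>A\<close>.\<close>

definition maximal_independent_set :: "nat \<Rightarrow> nat set set \<Rightarrow> nat set \<Rightarrow> bool" where
  "maximal_independent_set n E A \<longleftrightarrow>
     independent_set n E A \<and> (\<forall>v\<in>{1..n} - A. \<exists>a\<in>A. {v, a} \<in> E)"

lemma finite_independent_set: "independent_set n E A \<Longrightarrow> finite A"
  by (auto simp: independent_set_def intro: finite_subset)

text \<open>The annihilator of the monomial \<open>x\<^sub>A\<close> in the edge ring is the prime ideal generated by the
  variables outside \<open>A\<close>, so a regular sequence yields algebraically independent polynomials in the
  variables from \<open>A\<close>; counting monomials bounds its length.\<close>

lemma length_regular_on_le:
  fixes ys :: "'k::field mpoly list"
  assumes A: "maximal_independent_set n E A" and ys: "regular_on (full_ideal n E) ys"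
    and const: "\<And>y. y \<in> set ys \<Longrightarrow> 0 \<notin> keys y"
  shows "length ys \<le> card A"
proof (rule ccontr)
  assume "\<not> length ys \<le> card A"
  then have len: "card A < length ys" by simp
  have indep: "independent_set n E A" using A by (simp add: maximal_independent_set_def)
  have finA: "finite A" by (rule finite_independent_set[OF indep])
  define mA :: "nat \<Rightarrow>\<^sub>0 nat" where "mA = (\<Sum>a\<in>A. Poly_Mapping.single a 1)"
  define u :: "'k mpoly" where "u = Poly_Mapping.single mA 1"
  define zs where "zs = map (\<lambda>y. y ^ Suc (card A)) ys"
  have lookup_mA: "lookup mA v = (if v \<in> A then 1 else 0)" for v
    using finA by (simp add: mA_def lookup_sum lookup_single when_def)
  have keys_mA: "keys mA = A"
    by (auto simp: in_keys_iff lookup_mA split: if_splits)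
  have zs: "regular_on (full_ideal n E) zs"
    unfolding zs_def by (intro regular_on_map_power ring_ideal_full_ideal ys) simp
  have "u \<notin> adjoins (full_ideal n E) zs"
  proof
    assume u: "u \<in> adjoins (full_ideal n E) zs"
    \<comment> \<open>The ideal of monomials that vanish in the edge ring or have degree above
      \<open>card A\<close>. It contains \<open>zs\<close>, but not \<open>u\<close>, whose support
      \<open>A\<close> is independent and whose degree is exactly \<open>card A\<close>.\<close>
    define K where "K = {f :: 'k mpoly. keys f \<subseteq>
        {m. \<not> independent_set n E (keys m) \<or> Suc (card A) \<le> total_degree m}}"
    have "ring_ideal K" unfolding K_def
      by (rule ring_ideal_keys) (auto simp: keys_add_nat total_degree_add dest: independent_set_subset)
    moreover have "full_ideal n E \<subseteq> K" by (auto simp: full_ideal_def K_def)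
    moreover have "set zs \<subseteq> K"
      using keys_power_total_degree[OF const, of _ "Suc (card A)"]
      by (fastforce simp: K_def zs_def simp del: power_Suc)
    ultimately have "u \<in> K" using adjoins_minimal[of K "full_ideal n E" zs] u by blast
    moreover have "total_degree mA = card A"
      unfolding total_degree_def keys_mA by (simp add: lookup_mA)
    ultimately show False using indep by (simp add: K_def u_def keys_mA)
  qed
  note independent =
    regular_on_independent[of "Poly_Mapping.single 0", OF _ _ _ ring_ideal_full_ideal zs this]
  obtain D where D: "\<forall>f\<in>set zs. exponent_bound D f" using ex_exponent_bound_list by blast
  let ?d = "length zs" and ?k = "card A"
  \<comment> \<open>There are \<open>r ^ ?d\<close> power products, and the monomials over
    \<open>A\<close> occurring in them number at most \<open>(N + 1) ^ ?k\<close>, where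
    \<open>N + 1\<close> is at most \<open>r * (?d * D + 1)\<close>. Since \<open>?k < ?d\<close>,
    it suffices that \<open>r\<close> exceeds \<open>(?d * D + 1) ^ ?k\<close>.\<close>
  define r where "r = (?d * D + 1) ^ ?k + 1"
  define N where "N = ?d * (r * D)"
  define Y where "Y = {m. keys m \<subseteq> A \<and> (\<forall>v. lookup m v \<le> N)}"
  have finY: "finite Y" unfolding Y_def by (rule bounded_monomials(1)[OF finA])
  have "card Y \<le> (N + 1) ^ ?k"
    unfolding Y_def by (rule bounded_monomials(2)[OF finA])
  also have "\<dots> \<le> (r * (?d * D + 1)) ^ ?k"
    by (intro power_mono) (auto simp: N_def r_def algebra_simps)
  also have "\<dots> = r ^ ?k * (?d * D + 1) ^ ?k" by (rule power_mult_distrib)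
  also have "\<dots> < r ^ ?k * r" unfolding r_def by simp
  also have "\<dots> = r ^ Suc ?k" by simp
  also have "\<dots> \<le> r ^ ?d"
    using len by (intro power_increasing) (auto simp: r_def zs_def)
  finally have "card Y < card (exponents r ?d)" by (simp add: card_exponents)
  from homogeneous_system_nontrivial_solution[OF finY finite_exponents this,
      of "\<lambda>e m. lookup (power_product zs e) m"]
  obtain c where c: "\<exists>e\<in>exponents r ?d. c e \<noteq> 0"
      "\<forall>m\<in>Y. (\<Sum>e\<in>exponents r ?d. c e * lookup (power_product zs e) m) = 0"
    by blast
  \<comment> \<open>The relation \<open>c\<close> cancels only the coefficients at monomials over
    \<open>A\<close>; \<open>f\<close> itself may be nonzero, but it lies in the annihilator of
    \<open>u\<close>.\<close>
  define f where "f = (\<Sum>e\<in>exponents r ?d. Poly_Mapping.single 0 (c e) * power_product zs e)"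
  have f: "lookup f m = 0" if "keys m \<subseteq> A" for m
  proof (cases "m \<in> Y")
    case True
    then show ?thesis using c(2) by (simp add: f_def lookup_sum lookup_scalar_mult)
  next
    case False
    have "lookup (power_product zs e) m = 0" if "e \<in> exponents r ?d" for e
      using exponent_bound_power_product[OF D that] False \<open>keys m \<subseteq> A\<close>
      by (auto simp: exponent_bound_def Y_def N_def in_keys_iff subset_iff)
    then show ?thesis by (simp add: f_def lookup_sum lookup_scalar_mult)
  qed
  \<comment> \<open>Every monomial of \<open>f\<close> contains a variable \<open>v\<close> outside
    \<open>A\<close>. Multiplied by \<open>x_A\<close> it contains an edge from \<open>v\<close> to
    \<open>A\<close> by domination, unless \<open>v\<close> is not among the vertices at
    all.\<close>
  have "keys (f * u) \<subseteq> {m. \<not> independent_set n E (keys m)}"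
  proof (rule keys_mult_subset[of f "keys f" u "{mA}"])
    fix a b assume "a \<in> keys f" "b \<in> {mA}"
    then obtain v where v: "v \<in> keys a" "v \<notin> A" using f[of a] by (auto simp: in_keys_iff)
    have keys: "keys (a + b) = keys a \<union> A" using \<open>b \<in> {mA}\<close> by (simp add: keys_add_nat keys_mA)
    have "\<not> independent_set n E (keys (a + b))"
    proof (cases "v \<in> {1..n}")
      case True
      then obtain w where "w \<in> A" "{v, w} \<in> E"
        using v(2) A True unfolding maximal_independent_set_def by blast
      then have "v \<in> keys (a + b)" "w \<in> keys (a + b)" "{v, w} \<in> E" using v(1) by (auto simp: keys)
      then show ?thesis by (auto simp: independent_set_def)
    next
      case False
      then show ?thesis using v(1) unfolding keys independent_set_def by blast
    qed
    then show "a + b \<in> {m. \<not> independent_set n E (keys m)}" by simp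
  qed (auto simp: u_def)
  then have "f * u \<in> full_ideal n E" by (simp add: full_ideal_def)
  then have "\<forall>e\<in>exponents r ?d. c e = 0"
    using independent[of c r] unfolding f_def by (simp add: mult_single)
  then show False using c(1) by blast
qed

section \<open>Comparison of the ring with carrier \<open>poly_ring n\<close> and the full
  polynomial ring\<close>

context
  fixes n :: nat and R :: "'k::field mpoly ring"
  defines "R \<equiv> poly_ring n"
begin

interpretation R: cring R
  unfolding R_def by (rule cring_poly_ring)

lemma poly_ring_simps:
  "a \<otimes>\<^bsub>R\<^esub> b = a * b" "a \<oplus>\<^bsub>R\<^esub> b = a + b" "\<zero>\<^bsub>R\<^esub> = 0" "\<one>\<^bsub>R\<^esub> = 1"
  by (simp_all add: R_def poly_ring_def)

lemma carrier_poly_ring_iff: "f \<in> carrier R \<longleftrightarrow> (\<forall>m\<in>keys f. keys m \<subseteq> {1..n})"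
  by (simp add: R_def poly_ring_def)

lemma uminus_in_poly_ring: "f \<in> carrier R \<Longrightarrow> - f \<in> carrier R"
  by (simp add: carrier_poly_ring_iff)

lemma a_inv_poly_ring: "f \<in> carrier R \<Longrightarrow> \<ominus>\<^bsub>R\<^esub> f = - f"
  using uminus_in_poly_ring[of f] by (intro R.minus_equality) (simp_all add: poly_ring_simps)

lemma a_minus_poly_ring: "f \<in> carrier R \<Longrightarrow> g \<in> carrier R \<Longrightarrow> f \<ominus>\<^bsub>R\<^esub> g = f - g"
  by (simp add: a_minus_def a_inv_poly_ring poly_ring_simps)

lemma diff_in_poly_ring: "f \<in> carrier R \<Longrightarrow> g \<in> carrier R \<Longrightarrow> f - g \<in> carrier R"
  using R.minus_closed[of f g] by (simp only: a_minus_poly_ring)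

lemma ideal_ring_ideal_Int:
  assumes "ring_ideal J"
  shows "ideal (J \<inter> carrier R) R"
proof (rule idealI)
  note J = ring_idealD[OF assms]
  show "ring R" by (rule R.ring_axioms)
  show "subgroup (J \<inter> carrier R) (add_monoid R)"
  proof (rule R.add.subgroupI)
    show "J \<inter> carrier R \<noteq> {}" using J(1) R.zero_closed by (auto simp: poly_ring_simps)
    show "\<ominus>\<^bsub>R\<^esub> a \<in> J \<inter> carrier R" if "a \<in> J \<inter> carrier R" for a
      using that J(5) uminus_in_poly_ring by (simp add: a_inv_poly_ring)
    show "a \<oplus>\<^bsub>R\<^esub> b \<in> J \<inter> carrier R" if "a \<in> J \<inter> carrier R" "b \<in> J \<inter> carrier R" for a b
      using that J(2) R.a_closed[of a b] by (auto simp: poly_ring_simps)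
  qed auto
  show "x \<otimes>\<^bsub>R\<^esub> a \<in> J \<inter> carrier R" "a \<otimes>\<^bsub>R\<^esub> x \<in> J \<inter> carrier R"
    if "a \<in> J \<inter> carrier R" "x \<in> carrier R" for a x
    using that J(3,4) R.m_closed[of x a] R.m_closed[of a x] by (auto simp: poly_ring_simps)
qed

text \<open>A support that is not independent contains both ends of an edge, so the monomial is
  divisible by a generator; the cofactor \<open>m'\<close> stays within the variables of
  \<open>poly_ring n\<close>.\<close>

lemma edge_monomial_in_ideal:
  assumes I: "ideal I R" and E: "E \<subseteq> vertex_pairs n" and gens: "{Var i * Var j | i j. {i, j} \<in> E} \<subseteq> I"
    and m: "\<not> independent_set n E (keys m)" "keys m \<subseteq> {1..n}"
  shows "Poly_Mapping.single m c \<in> I"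
proof -
  obtain i j where ij: "i \<in> keys m" "j \<in> keys m" "{i, j} \<in> E"
    using m by (auto simp: independent_set_def)
  have "i \<noteq> j" using vertex_pairsD[OF E ij(3)] by blast
  define m' where "m' = m - (Poly_Mapping.single i 1 + Poly_Mapping.single j 1)"
  have "m' + (Poly_Mapping.single i 1 + Poly_Mapping.single j 1) = m"
    using ij(1,2) \<open>i \<noteq> j\<close> unfolding m'_def
    by (intro poly_mapping_eqI) (auto simp: lookup_add lookup_minus lookup_single when_def in_keys_iff)
  then have "Poly_Mapping.single m c = Poly_Mapping.single m' c * (Var i * Var j)"
    by (simp add: Var_def mult_single)
  moreover have "keys m' \<subseteq> {1..n}"
    using m(2) by (auto simp: m'_def in_keys_iff lookup_minus)
  then have "Poly_Mapping.single m' c \<in> carrier R"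
    by (auto simp: carrier_poly_ring_iff split: if_splits)
  then have "Poly_Mapping.single m' c \<otimes>\<^bsub>R\<^esub> (Var i * Var j) \<in> I"
    using gens ij(3) by (intro ideal.I_l_closed[OF I]) blast+
  ultimately show ?thesis by (simp add: poly_ring_simps)
qed

text \<open>One direction is minimality of the generated ideal. For the other, \<open>f\<close> is
  split into its terms, each of which is a multiple of a generator.\<close>

lemma edge_ideal_iff_full_ideal:
  assumes E: "E \<subseteq> vertex_pairs n" and f: "f \<in> carrier R"
  shows "f \<in> edge_ideal n E \<longleftrightarrow> f \<in> full_ideal n E"
proof
  have "(Var i * Var j :: 'k mpoly) \<in> full_ideal n E \<inter> carrier R" if "{i, j} \<in> E" for i j
  proof -
    have "i \<in> {1..n}" "j \<in> {1..n}"
      using vertex_pairsD[OF E that] by blast+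
    then have "Var i \<otimes>\<^bsub>R\<^esub> Var j \<in> carrier R"
      unfolding R_def by (intro cring.cring_simprules(5)[OF cring_poly_ring] Var_in_carrier)
    moreover have "Var i * Var j \<in> full_ideal n E"
      using that by (auto simp: full_ideal_def independent_set_def Var_def mult_single keys_add_nat)
    ultimately show ?thesis by (simp add: poly_ring_simps)
  qed
  then have "edge_ideal n E \<subseteq> full_ideal n E \<inter> carrier R"
    unfolding edge_ideal_def R_def[symmetric]
    by (intro R.genideal_minimal ideal_ring_ideal_Int ring_ideal_full_ideal) auto
  then show "f \<in> edge_ideal n E \<Longrightarrow> f \<in> full_ideal n E" by blast
next
  assume "f \<in> full_ideal n E"
  have I: "ideal (edge_ideal n E) R" unfolding R_def by (rule ideal_edge_ideal[OF E])
  interpret I: ideal "edge_ideal n E" R by (rule I)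
  have gens: "{Var i * Var j | i j. {i, j} \<in> E} \<subseteq> (edge_ideal n E :: 'k mpoly set)"
    unfolding edge_ideal_def genideal_def by blast
  have single: "Poly_Mapping.single m (lookup f m) \<in> edge_ideal n E" if "m \<in> keys f" for m
    using edge_monomial_in_ideal[OF I E gens, of m] that \<open>f \<in> full_ideal n E\<close> f
    by (auto simp: full_ideal_def carrier_poly_ring_iff)
  have "(\<Sum>m\<in>M. Poly_Mapping.single m (lookup f m)) \<in> edge_ideal n E" if "finite M" "M \<subseteq> keys f" for M
    using that
  proof (induction M rule: finite_induct)
    case empty
    then show ?case using I.zero_closed by (simp add: poly_ring_simps)
  next
    case (insert m M)
    then have "Poly_Mapping.single m (lookup f m) \<oplus>\<^bsub>R\<^esub> (\<Sum>m\<in>M. Poly_Mapping.single m (lookup f m))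
        \<in> edge_ideal n E"
      by (intro I.a_closed single insert.IH) auto
    with insert.hyps show ?case by (simp add: poly_ring_simps)
  qed
  from this[of "keys f"] show "f \<in> edge_ideal n E" by (simp add: poly_mapping_sum_single)
qed

lemma filter_keys_in_poly_ring: "filter_keys (\<lambda>m. keys m \<subseteq> {1..n}) f \<in> carrier R"
  by (simp add: carrier_poly_ring_iff keys_filter_keys)

lemma minus_filter_keys_in_full_ideal:
  "f - filter_keys (\<lambda>m. keys m \<subseteq> {1..n}) f \<in> full_ideal n E"
  by (auto simp: full_ideal_def independent_set_def keys_minus_filter_keys)

text \<open>Dropping the monomials with foreign variables does not change the class modulo
  \<open>full_ideal n E\<close>. This is how arbitrary cofactors are replaced by cofactors in the
  carrier.\<close>

lemma ex_poly_ring_representative: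
  obtains g where "g \<in> carrier R" "f - g \<in> full_ideal n E"
  using filter_keys_in_poly_ring minus_filter_keys_in_full_ideal by blast

section \<open>The edge ring as a quotient: ideals, regular sequences and primes\<close>

context
  fixes E :: "nat set set" and Q :: "'k mpoly set ring" and residue :: "'k mpoly \<Rightarrow> 'k mpoly set"
  assumes E: "E \<subseteq> vertex_pairs n"
  defines "Q \<equiv> edge_ring n E" and "residue \<equiv> \<lambda>f. edge_ideal n E +>\<^bsub>R\<^esub> f"
begin

interpretation I: ideal "edge_ideal n E" R
  unfolding R_def by (rule ideal_edge_ideal[OF E])

interpretation Q: cring Q
  unfolding Q_def by (rule cring_edge_ring[OF E])

interpretation residue: ring_hom_ring R Q residue
  using I.rcos_ring_hom_ring by (simp add: Q_def residue_def edge_ring_def R_def)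

lemma carrier_edge_ring: "carrier Q = residue ` carrier R"
  by (auto simp: Q_def residue_def edge_ring_def R_def FactRing_def A_RCOSETS_def')

lemma residue_mult: "f \<in> carrier R \<Longrightarrow> g \<in> carrier R \<Longrightarrow> residue (f * g) = residue f \<otimes>\<^bsub>Q\<^esub> residue g"
  using residue.hom_mult[of f g] by (simp add: poly_ring_simps)

lemma residue_add: "f \<in> carrier R \<Longrightarrow> g \<in> carrier R \<Longrightarrow> residue (f + g) = residue f \<oplus>\<^bsub>Q\<^esub> residue g"
  using residue.hom_add[of f g] by (simp add: poly_ring_simps)

lemma residue_eq_iff:
  assumes "f \<in> carrier R" "g \<in> carrier R"
  shows "residue f = residue g \<longleftrightarrow> f - g \<in> full_ideal n E"
proof -
  have "residue f = residue g \<longleftrightarrow> f \<ominus>\<^bsub>R\<^esub> g \<in> edge_ideal n E"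
    unfolding residue_def using assms R.quotient_eq_iff_same_a_r_cos[OF I.is_ideal] by blast
  also have "f \<ominus>\<^bsub>R\<^esub> g = f - g" by (rule a_minus_poly_ring[OF assms])
  also have "f - g \<in> edge_ideal n E \<longleftrightarrow> f - g \<in> full_ideal n E"
    using edge_ideal_iff_full_ideal[OF E diff_in_poly_ring[OF assms]] .
  finally show ?thesis .
qed

definition quotient_ideal :: "'k mpoly set \<Rightarrow> 'k mpoly set set" where
  "quotient_ideal J = residue ` (J \<inter> carrier R)"

lemma ideal_quotient_ideal:
  assumes "ring_ideal J"
  shows "ideal (quotient_ideal J) Q"
  using R.ring_ideal_imp_quot_ideal[OF I.is_ideal ideal_ring_ideal_Int[OF assms]]
  by (simp add: Q_def residue_def edge_ring_def R_def quotient_ideal_def)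

text \<open>The correspondence of ideals for the quotient map: an ideal \<open>J\<close> above
  \<open>full_ideal n E\<close> is a union of residue classes.\<close>

lemma residue_in_quotient_ideal_iff:
  assumes "ring_ideal J" "full_ideal n E \<subseteq> J" "f \<in> carrier R"
  shows "residue f \<in> quotient_ideal J \<longleftrightarrow> f \<in> J"
proof
  assume "residue f \<in> quotient_ideal J"
  then obtain g where g: "g \<in> J" "g \<in> carrier R" "residue f = residue g"
    by (auto simp: quotient_ideal_def)
  then have "f - g \<in> J" using assms(2) residue_eq_iff[OF assms(3) g(2)] by blast
  from ring_idealD(2)[OF assms(1) this g(1)] show "f \<in> J" by simp
qed (use assms(3) in \<open>auto simp: quotient_ideal_def\<close>)

lemma residue_in_genideal_iff:
  assumes "set ys \<subseteq> carrier R" "f \<in> carrier R"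
  shows "residue f \<in> Idl\<^bsub>Q\<^esub> (set (map residue ys)) \<longleftrightarrow> f \<in> adjoins (full_ideal n E) ys"
proof
  let ?J = "adjoins (full_ideal n E) ys"
  have J: "ring_ideal ?J" "full_ideal n E \<subseteq> ?J"
    by (rule ring_ideal_adjoins[OF ring_ideal_full_ideal], rule adjoins_superset)
  have "set (map residue ys) \<subseteq> quotient_ideal ?J"
    using assms(1) residue_in_quotient_ideal_iff[OF J] subset_adjoins[OF ring_ideal_full_ideal, of ys n E]
    by auto
  then have "Idl\<^bsub>Q\<^esub> (set (map residue ys)) \<subseteq> quotient_ideal ?J"
    by (intro Q.genideal_minimal ideal_quotient_ideal J(1))
  then show "residue f \<in> Idl\<^bsub>Q\<^esub> (set (map residue ys)) \<Longrightarrow> f \<in> ?J"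
    using residue_in_quotient_ideal_iff[OF J assms(2)] by blast
next
  assume "f \<in> adjoins (full_ideal n E) ys"
  then show "residue f \<in> Idl\<^bsub>Q\<^esub> (set (map residue ys))"
    using assms
  proof (induction ys arbitrary: f rule: rev_induct)
    case Nil
    have "residue f = residue 0"
      using Nil residue_eq_iff[of f 0] R.zero_closed by (simp add: poly_ring_simps)
    also have "\<dots> = \<zero>\<^bsub>Q\<^esub>" using residue.hom_zero by (simp add: poly_ring_simps)
    also have "\<dots> \<in> Idl\<^bsub>Q\<^esub> (set (map residue []))"
      by (intro additive_subgroup.zero_closed ideal.axioms(1) Q.genideal_ideal) simp
    finally show ?case .
  next
    case (snoc y ys)
    have y: "y \<in> carrier R" and ys: "set ys \<subseteq> carrier R" using snoc.prems(2) by auto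
    let ?K = "Idl\<^bsub>Q\<^esub> (set (map residue (ys @ [y])))"
    have sub: "set (map residue (ys @ [y])) \<subseteq> carrier Q"
      using snoc.prems(2) by (auto simp: carrier_edge_ring)
    then have K: "ideal ?K Q" by (rule Q.genideal_ideal)
    obtain a c where ac: "a \<in> adjoins (full_ideal n E) ys" "f = a + y * c"
      using snoc.prems(1) unfolding foldl_append foldl_Cons foldl_Nil by (rule adjoinE)
    obtain c' where c': "c' \<in> carrier R" "c - c' \<in> full_ideal n E"
      by (rule ex_poly_ring_representative)
    \<comment> \<open>The error \<open>y * (c - c')\<close> made by replacing \<open>c\<close> lies
      in \<open>full_ideal n E\<close> and is absorbed into \<open>a'\<close>, which thus falls
      under the induction hypothesis.\<close>
    define a' where "a' = f - y * c'"
    note J = ring_idealD[OF ring_ideal_adjoins[OF ring_ideal_full_ideal, of n E ys]]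
    have yc': "y * c' \<in> carrier R" using R.m_closed[OF y c'(1)] by (simp add: poly_ring_simps)
    have "a' = a + y * (c - c')" by (simp add: a'_def ac(2) algebra_simps)
    then have "a' \<in> adjoins (full_ideal n E) ys"
      using J(2)[OF ac(1) J(3)] c'(2) adjoins_superset by blast
    moreover have a'C: "a' \<in> carrier R"
      unfolding a'_def by (rule diff_in_poly_ring[OF snoc.prems(3) yc'])
    ultimately have "residue a' \<in> Idl\<^bsub>Q\<^esub> (set (map residue ys))"
      using snoc.IH ys by blast
    also have "\<dots> \<subseteq> ?K"
      using Q.genideal_self[OF sub] by (intro Q.genideal_minimal[OF K]) auto
    finally have "residue a' \<in> ?K" .
    moreover have "residue y \<in> ?K" using Q.genideal_self[OF sub] by auto
    then have "residue y \<otimes>\<^bsub>Q\<^esub> residue c' \<in> ?K"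
      using c'(1) by (intro ideal.I_r_closed[OF K]) (auto simp: carrier_edge_ring)
    ultimately have "residue a' \<oplus>\<^bsub>Q\<^esub> residue (y * c') \<in> ?K"
      unfolding residue_mult[OF y c'(1)]
      by (intro additive_subgroup.a_closed ideal.axioms(1)[OF K])
    then have "residue (a' + y * c') \<in> ?K"
      using residue_add[OF a'C yc'] by simp
    then show ?case by (simp add: a'_def)
  qed
qed

text \<open>The goal ranges over all polynomials \<open>a\<close>, the hypothesis only over classes
  of carrier elements; a representative \<open>a'\<close> differing from \<open>a\<close> by an
  element of \<open>full_ideal n E\<close> mediates.\<close>

lemma regular_sequence_imp_regular_on:
  assumes "regular_sequence Q (map residue ys)" "set ys \<subseteq> carrier R"
  shows "regular_on (full_ideal n E) ys"
  unfolding regular_on_conv_nth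
proof (intro allI impI)
  fix i a
  assume i: "i < length ys" and ya: "ys ! i * a \<in> adjoins (full_ideal n E) (take i ys)"
  note J = ring_idealD[OF ring_ideal_adjoins[OF ring_ideal_full_ideal, of n E "take i ys"]]
  have y: "ys ! i \<in> carrier R" using assms(2) i by auto
  have ys: "set (take i ys) \<subseteq> carrier R" using assms(2) set_take_subset by fast
  obtain a' where a': "a' \<in> carrier R" "a - a' \<in> full_ideal n E"
    by (rule ex_poly_ring_representative)
  have aa': "a - a' \<in> adjoins (full_ideal n E) (take i ys)"
    using a'(2) adjoins_superset by blast
  have "ys ! i * a' = ys ! i * a - ys ! i * (a - a')" by (simp add: algebra_simps)
  also have "\<dots> \<in> adjoins (full_ideal n E) (take i ys)"
    by (rule J(6)[OF ya J(3)[OF aa']])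
  finally have "residue (ys ! i * a') \<in> Idl\<^bsub>Q\<^esub> (set (map residue (take i ys)))"
    using R.m_closed[OF y a'(1)] by (subst residue_in_genideal_iff[OF ys]) (simp_all add: poly_ring_simps)
  then have "map residue ys ! i \<otimes>\<^bsub>Q\<^esub> residue a' \<in> Idl\<^bsub>Q\<^esub> (set (take i (map residue ys)))"
    using i residue_mult[OF y a'(1)] by (simp add: take_map)
  moreover have "residue a' \<in> carrier Q" using a'(1) by (simp add: carrier_edge_ring)
  ultimately have "residue a' \<in> Idl\<^bsub>Q\<^esub> (set (take i (map residue ys)))"
    using assms(1) i unfolding regular_sequence_def length_map by blast
  then have "a' \<in> adjoins (full_ideal n E) (take i ys)"
    using residue_in_genideal_iff[OF ys a'(1)] by (simp only: take_map)
  from J(2)[OF aa' this] show "a \<in> adjoins (full_ideal n E) (take i ys)" by simp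
qed

text \<open>The polynomials without constant term form an ideal that contains the variables and,
  because the empty set is independent, also \<open>full_ideal n E\<close>.\<close>

lemma irrelevant_ideal_constant_term:
  assumes "residue f \<in> irrelevant_ideal n E" "f \<in> carrier R"
  shows "0 \<notin> keys f"
proof -
  let ?J = "{f :: 'k mpoly. keys f \<subseteq> - {0}}"
  have J: "ring_ideal ?J"
    by (rule ring_ideal_keys) (metis Compl_iff poly_mapping_nat_add_eq_0_iff singletonD singletonI)
  have "independent_set n E {}" by (simp add: independent_set_def)
  then have "full_ideal n E \<subseteq> ?J" by (force simp: full_ideal_def)
  note iff = residue_in_quotient_ideal_iff[OF J this]
  have "irrelevant_ideal n E \<subseteq> quotient_ideal ?J"
    unfolding irrelevant_ideal_def Q_def[symmetric] R_def[symmetric] residue_def[symmetric]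
  proof (intro Q.genideal_minimal ideal_quotient_ideal J subsetI)
    fix x assume "x \<in> {residue (Var i) | i. i \<in> {1..n}}"
    then obtain i where i: "x = residue (Var i)" "i \<in> {1..n}" by blast
    have "keys (Var i :: 'k mpoly) \<subseteq> - {0}"
      by (auto simp: Var_def poly_mapping_eq_iff fun_eq_iff lookup_single when_def)
    moreover have "(Var i :: 'k mpoly) \<in> carrier R"
      unfolding R_def by (rule Var_in_carrier[OF i(2)])
    ultimately show "x \<in> quotient_ideal ?J" unfolding i(1) using iff by blast
  qed
  then show ?thesis using assms iff by blast
qed

lemma primeideal_quotient_ideal:
  assumes J: "ring_ideal J" "full_ideal n E \<subseteq> J" "1 \<notin> J"
    and prime: "\<And>a b. a * b \<in> J \<Longrightarrow> a \<in> J \<or> b \<in> J"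
  shows "primeideal (quotient_ideal J) Q"
proof (rule primeidealI)
  note iff = residue_in_quotient_ideal_iff[OF J(1,2)]
  have "residue 1 \<notin> quotient_ideal J"
    using iff[of 1] J(3) R.one_closed by (simp add: poly_ring_simps)
  moreover have "residue 1 \<in> carrier Q"
    using R.one_closed by (simp add: carrier_edge_ring poly_ring_simps)
  ultimately show "carrier Q \<noteq> quotient_ideal J" by blast
  fix x y assume "x \<in> carrier Q" "y \<in> carrier Q" and xy: "x \<otimes>\<^bsub>Q\<^esub> y \<in> quotient_ideal J"
  then obtain f g where fg: "f \<in> carrier R" "x = residue f" "g \<in> carrier R" "y = residue g"
    by (auto simp: carrier_edge_ring)
  have "f * g \<in> J"
    using xy iff[of "f * g"] R.m_closed[of f g] fg by (simp add: residue_mult poly_ring_simps)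
  then show "x \<in> quotient_ideal J \<or> y \<in> quotient_ideal J"
    using prime fg iff by blast
qed (use ideal_quotient_ideal[OF J(1)] Q.is_cring in auto)

text \<open>The chain starts at the prime generated by the variables outside \<open>B\<close>, which
  contains all edges since \<open>B\<close> is independent, and adds the variables of
  \<open>B\<close> one at a time.\<close>

lemma krull_dim_edge_ring_ge:
  assumes B: "independent_set n E B"
  shows "enat (card B) \<le> krull_dim Q"
proof -
  obtain xs where xs: "set xs = B" "distinct xs"
    using finite_distinct_list[OF finite_independent_set[OF B]] by blast
  define J where "J i = {f :: 'k mpoly. keys f \<subseteq> {m. \<not> keys m \<subseteq> set (drop i xs)}}" for i
  have sub: "set (drop i xs) \<subseteq> B" for i using set_drop_subset xs(1) by fast
  have J: "ring_ideal (J i)" for i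
    unfolding J_def by (rule ring_ideal_keys) (auto simp: keys_add_nat)
  have full: "full_ideal n E \<subseteq> J i" for i
    using independent_set_subset[OF independent_set_subset[OF B sub]]
    by (auto simp: full_ideal_def J_def)
  note iff = residue_in_quotient_ideal_iff[OF J full]
  have "primeideal (quotient_ideal (J i)) Q" for i
    using prime_no_keys[where 'k='k and T = "set (drop i xs)"]
    by (intro primeideal_quotient_ideal J full) (auto simp: J_def)
  moreover have "quotient_ideal (J i) \<subset> quotient_ideal (J (Suc i))" if i: "i < card B" for i
  proof -
    have len: "i < length xs" using i xs distinct_card by fastforce
    have drop: "drop i xs = xs ! i # drop (Suc i) xs" by (rule Cons_nth_drop_Suc[OF len, symmetric])
    have notin: "xs ! i \<notin> set (drop (Suc i) xs)"
      using xs(2) distinct_drop[of xs i] by (simp add: drop)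
    have "xs ! i \<in> {1..n}" using B nth_mem[OF len] xs(1) by (auto simp: independent_set_def)
    then have V: "(Var (xs ! i) :: 'k mpoly) \<in> carrier R" unfolding R_def by (rule Var_in_carrier)
    have "(Var (xs ! i) :: 'k mpoly) \<in> J (Suc i)" "(Var (xs ! i) :: 'k mpoly) \<notin> J i"
      using notin by (auto simp: J_def Var_def drop)
    then have "residue (Var (xs ! i)) \<in> quotient_ideal (J (Suc i))"
        "residue (Var (xs ! i)) \<notin> quotient_ideal (J i)"
      using iff[OF V] by blast+
    moreover have "J i \<subseteq> J (Suc i)" by (auto simp: J_def drop)
    then have "quotient_ideal (J i) \<subseteq> quotient_ideal (J (Suc i))" by (auto simp: quotient_ideal_def)
    ultimately show ?thesis by blast
  qed
  ultimately show ?thesis unfolding krull_dim_def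
    by (intro Sup_upper CollectI exI[of _ "card B"] conjI refl exI[of _ "\<lambda>i. quotient_ideal (J i)"]) auto
qed

lemma depth_edge_ring_le:
  assumes A: "maximal_independent_set n E A"
  shows "depth Q (irrelevant_ideal n E) \<le> enat (card A)"
  unfolding depth_def
proof (rule Sup_least)
  fix l assume "l \<in> {enat (length xs) | xs. regular_sequence Q xs \<and> set xs \<subseteq> irrelevant_ideal n E}"
  then obtain xs where xs: "l = enat (length xs)" "regular_sequence Q xs"
      "set xs \<subseteq> irrelevant_ideal n E"
    by blast
  have "xs \<in> lists (residue ` carrier R)"
    using xs(2) by (auto simp: regular_sequence_def carrier_edge_ring)
  then obtain ys where ys: "set ys \<subseteq> carrier R" "xs = map residue ys"
    unfolding lists_image by auto
  have "length ys \<le> card A"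
  proof (rule length_regular_on_le[OF A])
    show "regular_on (full_ideal n E) ys"
      using xs(2) ys by (intro regular_sequence_imp_regular_on) auto
    show "0 \<notin> keys y" if "y \<in> set ys" for y
      using that xs(3) ys by (intro irrelevant_ideal_constant_term) auto
  qed
  then show "l \<le> enat (card A)" using xs(1) ys(2) by simp
qed

end

end

lemma not_cohen_macaulay_graph:
  assumes "E \<subseteq> vertex_pairs n" "maximal_independent_set n E A" "independent_set n E B" "card A < card B"
  shows "\<not> cohen_macaulay_graph TYPE('k::field) n E"
proof -
  have "depth (edge_ring n E :: 'k mpoly set ring) (irrelevant_ideal n E) \<le> enat (card A)"
    by (rule depth_edge_ring_le[OF assms(1,2)])
  also have "\<dots> < enat (card B)" using assms(4) by simp
  also have "\<dots> \<le> krull_dim (edge_ring n E :: 'k mpoly set ring)"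
    by (rule krull_dim_edge_ring_ge[OF assms(1,3)])
  finally show ?thesis by (simp add: cohen_macaulay_graph_def)
qed


section \<open>Independent sets in random graphs\<close>

fun greedy :: "nat set set \<Rightarrow> nat \<Rightarrow> nat set" where
  "greedy E 0 = {}"
| "greedy E (Suc v) =
     (if \<exists>a\<in>greedy E v. {Suc v, a} \<in> E then greedy E v else insert (Suc v) (greedy E v))"

lemma greedy_subset: "greedy E v \<subseteq> {1..v}"
proof (induction v)
  case (Suc v)
  then have "greedy E v \<subseteq> {1..Suc v}" by (rule order_trans) auto
  then show ?case by auto
qed simp

lemma finite_greedy: "finite (greedy E v)"
  by (rule finite_subset[OF greedy_subset]) simp

text \<open>The choice among the first \<open>v\<close> vertices inspects only edges within
  \<open>{1..v}\<close>. The pairs containing \<open>Suc v\<close> therefore remain independent of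
  it, which \<open>prob_greedy_extends\<close> exploits.\<close>

lemma greedy_cong:
  assumes "\<And>e. e \<subseteq> {1..v} \<Longrightarrow> e \<in> E \<longleftrightarrow> e \<in> E'"
  shows "greedy E v = greedy E' v"
  using assms
proof (induction v)
  case (Suc v)
  have IH: "greedy E v = greedy E' v"
  proof (rule Suc.IH)
    show "e \<in> E \<longleftrightarrow> e \<in> E'" if "e \<subseteq> {1..v}" for e
    proof (rule Suc.prems)
      show "e \<subseteq> {1..Suc v}" using that by (rule order_trans) auto
    qed
  qed
  have "{Suc v, a} \<in> E \<longleftrightarrow> {Suc v, a} \<in> E'" if "a \<in> greedy E' v" for a
    using that greedy_subset[of E' v] by (intro Suc.prems) auto
  then show ?case using IH by auto
qed simp

lemma greedy_independent:
  assumes "\<And>i. {i} \<notin> E" "i \<in> greedy E v" "j \<in> greedy E v"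
  shows "{i, j} \<notin> E"
  using assms(2,3)
proof (induction v)
  case (Suc v)
  then show ?case using assms(1) by (auto simp: insert_commute split: if_splits)
qed simp

lemma greedy_dominates:
  assumes "w \<in> {1..v}" "w \<notin> greedy E v"
  shows "\<exists>a\<in>greedy E v. {w, a} \<in> E"
  using assms
proof (induction v)
  case (Suc v)
  show ?case
  proof (cases "w = Suc v")
    case True
    then show ?thesis using Suc.prems by (auto split: if_splits)
  next
    case False
    then have "w \<in> {1..v}" "w \<notin> greedy E v" using Suc.prems by (auto split: if_splits)
    from Suc.IH[OF this] show ?thesis by auto
  qed
qed simp

lemma maximal_independent_set_greedy:
  assumes "E \<subseteq> vertex_pairs n"
  shows "maximal_independent_set n E (greedy E n)"
proof -
  have "{i} \<notin> E" for i using vertex_pairsD(3)[OF assms, of i i] by auto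
  then show ?thesis
    using greedy_subset[of E n] greedy_independent greedy_dominates
    unfolding maximal_independent_set_def independent_set_def by blast
qed

section \<open>Independence of edge events and the size of the greedy set\<close>

lemma finite_vertex_pairs: "finite (vertex_pairs n)"
  by (rule finite_subset[of _ "Pow {1..n}"]) (auto simp: vertex_pairs_def)

lemma random_graph_subset: "E \<in> set_pmf (random_graph n p) \<Longrightarrow> E \<subseteq> vertex_pairs n"
  by (auto simp: random_graph_def)

lemma prob_pair_pmf_Times:
  "measure_pmf.prob (pair_pmf M N) (A \<times> B) = measure_pmf.prob M A * measure_pmf.prob N B"
proof -
  have "measure_pmf.prob (pair_pmf M N) (A \<times> B)
      = measure_pmf.prob (pair_pmf M N) ((A \<inter> set_pmf M) \<times> (B \<inter> set_pmf N))"
    using measure_Int_set_pmf[of "pair_pmf M N" "A \<times> B"] by (simp add: Times_Int_Times)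
  also have "\<dots> = measure_pmf.prob M (A \<inter> set_pmf M) * measure_pmf.prob N (B \<inter> set_pmf N)"
    by (rule measure_pmf_prob_product) (auto intro: countable_subset[OF _ countable_set_pmf])
  finally show ?thesis by (simp add: measure_Int_set_pmf)
qed

context
  fixes n :: nat and p :: real
  assumes p: "0 \<le> p" "p \<le> 1"
begin

abbreviation prob_graph :: "nat set set set \<Rightarrow> real" where
  "prob_graph \<equiv> measure_pmf.prob (random_graph n p)"

lemma prob_avoid_edges:
  assumes W: "W \<subseteq> vertex_pairs n"
  shows "prob_graph {E. E \<inter> W = {}} = (1 - p) ^ card W"
proof -
  let ?M = "Pi_pmf (vertex_pairs n) False (\<lambda>_. bernoulli_pmf p)"
  have "prob_graph {E. E \<inter> W = {}}
      = measure_pmf.prob ?M (Pi (vertex_pairs n) (\<lambda>e. if e \<in> W then {False} else UNIV))"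
    unfolding random_graph_def measure_map_pmf
    using W by (intro arg_cong[where f = "measure_pmf.prob ?M"]) (auto simp: Pi_def)
  also have "\<dots> = (\<Prod>e\<in>vertex_pairs n. if e \<in> W then 1 - p else 1)"
    unfolding measure_Pi_pmf_Pi[OF finite_vertex_pairs]
    using p by (intro prod.cong) (auto simp: measure_pmf_single)
  also have "\<dots> = (1 - p) ^ card W"
    using W by (simp add: prod.If_cases finite_vertex_pairs Int_absorb1)
  finally show ?thesis .
qed

text \<open>The condition on \<open>F\<close> says that the event is decided by the pairs outside
  \<open>W\<close>. Splitting the product distribution into the pairs outside and inside
  \<open>W\<close> turns the joint event into a rectangle.\<close>

lemma prob_independent_edges:
  assumes W: "W \<subseteq> vertex_pairs n" and F: "\<And>E. F E \<longleftrightarrow> F (E - W)"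
  shows "prob_graph {E. F E \<and> E \<inter> W = {}} = prob_graph {E. F E} * (1 - p) ^ card W"
proof -
  let ?V = "vertex_pairs n - W" and ?B = "\<lambda>_. bernoulli_pmf p"
  let ?M = "Pi_pmf ?V False ?B" and ?N = "Pi_pmf W False ?B"
  have fin: "finite ?V" "finite W"
    using finite_vertex_pairs finite_subset[OF W] by auto
  have V: "vertex_pairs n = ?V \<union> W" using W by blast
  have "Pi_pmf (vertex_pairs n) False ?B
      = map_pmf (\<lambda>(f, g) e. if e \<in> ?V then f e else g e) (pair_pmf ?M ?N)"
    by (subst V, rule Pi_pmf_union) (use fin in auto)
  moreover define comb where "comb = (\<lambda>(f, g). {e \<in> vertex_pairs n. if e \<in> ?V then f e else g e})"
  ultimately have G: "random_graph n p = map_pmf comb (pair_pmf ?M ?N)"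
    by (simp add: random_graph_def map_pmf_comp case_prod_unfold)
  define A where "A = {f. F {e \<in> ?V. f e}}"
  have "comb (f, g) - W = {e \<in> ?V. f e}" for f g
    by (auto simp: comb_def)
  then have Fcomb: "F (comb (f, g)) \<longleftrightarrow> f \<in> A" for f g
    unfolding A_def using F[of "comb (f, g)"] by simp
  have avoid: "comb (f, g) \<inter> W = {} \<longleftrightarrow> (\<forall>e\<in>W. \<not> g e)" for f g
    using W by (auto simp: comb_def)
  have "comb -` {E. F E} = A \<times> UNIV" using Fcomb by auto
  then have 1: "prob_graph {E. F E} = measure_pmf.prob ?M A"
    unfolding G measure_map_pmf by (simp add: prob_pair_pmf_Times)
  have "comb -` {E. F E \<and> E \<inter> W = {}} = A \<times> {g. \<forall>e\<in>W. \<not> g e}"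
  proof (rule Set.set_eqI)
    fix x :: "(nat set \<Rightarrow> bool) \<times> (nat set \<Rightarrow> bool)"
    obtain f g where "x = (f, g)" by (cases x)
    then show "x \<in> comb -` {E. F E \<and> E \<inter> W = {}} \<longleftrightarrow> x \<in> A \<times> {g. \<forall>e\<in>W. \<not> g e}"
      by (simp add: Fcomb avoid)
  qed
  then have "prob_graph {E. F E \<and> E \<inter> W = {}}
      = measure_pmf.prob (pair_pmf ?M ?N) (A \<times> {g. \<forall>e\<in>W. \<not> g e})"
    unfolding G measure_map_pmf by simp
  also have "\<dots> = measure_pmf.prob ?M A * measure_pmf.prob ?N (Pi W (\<lambda>_. {False}))"
    unfolding prob_pair_pmf_Times by (simp add: Pi_def Ball_def)
  also have "measure_pmf.prob ?N (Pi W (\<lambda>_. {False})) = (1 - p) ^ card W"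
    using p by (simp add: measure_Pi_pmf_Pi fin measure_pmf_single)
  finally show ?thesis using 1 by simp
qed

text \<open>Given that the greedy set is a fixed \<open>T\<close> of size \<open>j\<close>, the
  \<open>j\<close> pairs joining \<open>Suc v\<close> to \<open>T\<close> are still undecided and
  are all absent with probability \<open>(1 - p) ^ j\<close>. The probabilities of the different
  values \<open>T\<close> sum to at most 1.\<close>

lemma prob_greedy_extends:
  assumes v: "v < n"
  shows "prob_graph {E. card (greedy E v) = j \<and> (\<forall>a\<in>greedy E v. {Suc v, a} \<notin> E)} \<le> (1 - p) ^ j"
proof -
  define TT where "TT = {T. T \<subseteq> {1..v} \<and> card T = j}"
  define W where "W T = (\<lambda>a. {Suc v, a}) ` T" for T :: "nat set"
  have finTT: "finite TT" by (rule finite_subset[of _ "Pow {1..v}"]) (auto simp: TT_def)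
  have prob_T: "prob_graph {E. greedy E v = T \<and> E \<inter> W T = {}} = prob_graph {E. greedy E v = T} * (1 - p) ^ j"
    if "T \<in> TT" for T
  proof -
    have T: "T \<subseteq> {1..v}" "card T = j" using that by (auto simp: TT_def)
    have "W T \<subseteq> vertex_pairs n"
    proof
      fix e assume "e \<in> W T"
      then obtain a where "a \<in> T" "e = {a, Suc v}" by (auto simp: W_def insert_commute)
      then have "e = {a, Suc v} \<and> 1 \<le> a \<and> a < Suc v \<and> Suc v \<le> n" using T v by auto
      then show "e \<in> vertex_pairs n" unfolding vertex_pairs_def by blast
    qed
    moreover have "greedy E v = T \<longleftrightarrow> greedy (E - W T) v = T" for E
      by (subst greedy_cong[of v E "E - W T"]) (auto simp: W_def)
    ultimately have "prob_graph {E. greedy E v = T \<and> E \<inter> W T = {}}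
        = prob_graph {E. greedy E v = T} * (1 - p) ^ card (W T)"
      by (rule prob_independent_edges)
    moreover have "inj_on (\<lambda>a. {Suc v, a}) T" by (auto simp: inj_on_def doubleton_eq_iff)
    then have "card (W T) = j" unfolding W_def using T(2) by (simp add: card_image)
    ultimately show ?thesis by simp
  qed
  have "prob_graph {E. card (greedy E v) = j \<and> (\<forall>a\<in>greedy E v. {Suc v, a} \<notin> E)}
      \<le> prob_graph (\<Union>T\<in>TT. {E. greedy E v = T \<and> E \<inter> W T = {}})"
    using greedy_subset[of _ v] by (intro measure_pmf.finite_measure_mono) (auto simp: TT_def W_def)
  also have "\<dots> \<le> (\<Sum>T\<in>TT. prob_graph {E. greedy E v = T \<and> E \<inter> W T = {}})"
    using finTT by (intro measure_pmf.finite_measure_subadditive_finite) auto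
  also have "\<dots> = (\<Sum>T\<in>TT. pmf (map_pmf (\<lambda>E. greedy E v) (random_graph n p)) T) * (1 - p) ^ j"
    unfolding sum_distrib_right
    by (intro sum.cong) (simp_all add: prob_T pmf_map vimage_def)
  also have "\<dots> \<le> 1 * (1 - p) ^ j"
    using p finTT by (intro mult_right_mono) (simp_all add: measure_measure_pmf_finite[symmetric])
  finally show ?thesis by simp
qed

text \<open>The set grows by one vertex at a time, so to exceed \<open>j\<close> it must be extended
  at a moment when it has exactly \<open>j\<close> elements; a union bound over the \<open>v\<close>
  possible moments follows.\<close>

lemma prob_greedy_large: "v \<le> n \<Longrightarrow> prob_graph {E. j < card (greedy E v)} \<le> v * (1 - p) ^ j"
proof (induction v)
  case (Suc v)
  let ?X = "{E. card (greedy E v) = j \<and> (\<forall>a\<in>greedy E v. {Suc v, a} \<notin> E)}"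
  have "prob_graph {E. j < card (greedy E (Suc v))} \<le> prob_graph ({E. j < card (greedy E v)} \<union> ?X)"
    using finite_greedy[of _ v]
    by (intro measure_pmf.finite_measure_mono) (auto split: if_splits simp: card_insert_if)
  also have "\<dots> \<le> prob_graph {E. j < card (greedy E v)} + prob_graph ?X"
    by (rule measure_Un_le) auto
  also have "\<dots> \<le> v * (1 - p) ^ j + (1 - p) ^ j"
    using Suc by (intro add_mono prob_greedy_extends) auto
  finally show ?case by (simp add: algebra_simps)
qed simp

end

section \<open>Large independent sets by the second moment method\<close>

definition pairs_of :: "nat set \<Rightarrow> nat set set" where
  "pairs_of S = {e. e \<subseteq> S \<and> card e = 2}"

lemma card_pairs_of: "finite S \<Longrightarrow> card (pairs_of S) = card S choose 2"
  unfolding pairs_of_def by (rule n_subsets)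

lemma finite_pairs_of: "finite S \<Longrightarrow> finite (pairs_of S)"
  unfolding pairs_of_def by (rule finite_subset[of _ "Pow S"]) auto

lemma pairs_of_Int: "pairs_of S \<inter> pairs_of T = pairs_of (S \<inter> T)"
  by (auto simp: pairs_of_def)

lemma pairs_of_subset_vertex_pairs:
  assumes "S \<subseteq> {1..n}"
  shows "pairs_of S \<subseteq> vertex_pairs n"
proof
  fix e assume "e \<in> pairs_of S"
  then have e: "e \<subseteq> {1..n}" "card e = 2" using assms by (auto simp: pairs_of_def)
  then obtain x y where xy: "e = {x, y}" "x \<noteq> y" by (meson card_2_iff)
  then have "e = {min x y, max x y}" "1 \<le> min x y" "min x y < max x y" "max x y \<le> n"
    using e(1) by (auto simp: min_def max_def)
  then show "e \<in> vertex_pairs n" unfolding vertex_pairs_def by blast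
qed

lemma independent_set_iff_pairs_of:
  assumes "E \<subseteq> vertex_pairs n" "S \<subseteq> {1..n}"
  shows "independent_set n E S \<longleftrightarrow> E \<inter> pairs_of S = {}"
proof
  assume "independent_set n E S"
  then show "E \<inter> pairs_of S = {}"
    by (auto simp: independent_set_def pairs_of_def card_2_iff)
next
  assume *: "E \<inter> pairs_of S = {}"
  have "{i, j} \<notin> E" if "i \<in> S" "j \<in> S" for i j
  proof
    assume "{i, j} \<in> E"
    then have "i \<noteq> j" using vertex_pairsD(3)[OF assms(1)] by blast
    then have "{i, j} \<in> pairs_of S" using that by (auto simp: pairs_of_def)
    then show False using * \<open>{i, j} \<in> E\<close> by blast
  qed
  then show "independent_set n E S" using assms(2) by (simp add: independent_set_def)
qed

text \<open>Divide the vertices into \<open>k\<close> blocks of \<open>s\<close> vertices and pick the vertex number \<open>g i\<close> of the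
  \<open>i\<close>-th block. Restricting to such sets turns the second moment into a product over the blocks.\<close>

definition transversal :: "nat \<Rightarrow> nat \<Rightarrow> (nat \<Rightarrow> nat) \<Rightarrow> nat set" where
  "transversal s k g = (\<lambda>i. i * s + g i + 1) ` {..<k}"

lemma block_index_eq:
  fixes a b s i j :: nat
  assumes "a < s" "b < s" "i * s + a = j * s + b"
  shows "i = j" "a = b"
proof -
  have "(i * s + a) div s = i" using assms(1) by simp
  moreover have "(j * s + b) div s = j" using assms(2) by simp
  ultimately show "i = j" using assms(3) by simp
  then show "a = b" using assms(3) by simp
qed

context
  fixes n s k :: nat and F
  assumes size: "k * s \<le> n"
  defines "F \<equiv> {..<k} \<rightarrow>\<^sub>E {..<s}"
begin

lemma card_choices: "card F = s ^ k"
  unfolding F_def by (simp add: card_PiE)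

lemma choiceD: "g \<in> F \<Longrightarrow> i < k \<Longrightarrow> g i < s"
  unfolding F_def by (auto simp: PiE_def Pi_def)

lemma transversal_subset:
  assumes "g \<in> F"
  shows "transversal s k g \<subseteq> {1..n}"
proof
  fix x assume "x \<in> transversal s k g"
  then obtain i where i: "i < k" "x = i * s + g i + 1" by (auto simp: transversal_def)
  have "i * s + g i + 1 \<le> Suc i * s" using choiceD[OF assms i(1)] by simp
  also have "\<dots> \<le> k * s" using i(1) by (intro mult_right_mono) auto
  finally show "x \<in> {1..n}" using size i(2) by simp
qed

lemma finite_transversal: "finite (transversal s k g)"
  by (simp add: transversal_def)

lemma inj_on_transversal:
  assumes "g \<in> F"
  shows "inj_on (\<lambda>i. i * s + g i + 1) {..<k}"
proof (rule inj_onI)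
  fix i j assume ij: "i \<in> {..<k}" "j \<in> {..<k}" "i * s + g i + 1 = j * s + g j + 1"
  show "i = j"
    by (rule block_index_eq(1)[of "g i" s "g j"]) (use choiceD[OF assms] ij in simp_all)
qed

lemma card_transversal:
  assumes "g \<in> F"
  shows "card (transversal s k g) = k"
  unfolding transversal_def card_image[OF inj_on_transversal[OF assms]] by simp

text \<open>Blocks are disjoint, so a common vertex can only come from equal choices in the same
  block.\<close>

lemma card_transversal_Int:
  assumes "g \<in> F" "h \<in> F"
  shows "card (transversal s k g \<inter> transversal s k h) = card {i. i < k \<and> h i = g i}"
proof -
  have "transversal s k g \<inter> transversal s k h = (\<lambda>i. i * s + g i + 1) ` {i. i < k \<and> h i = g i}"
  proof (intro equalityI subsetI)
    fix x assume "x \<in> transversal s k g \<inter> transversal s k h"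
    then obtain i j where ij: "i < k" "j < k" "x = i * s + g i + 1" "x = j * s + h j + 1"
      by (auto simp: transversal_def)
    then have eq: "i * s + g i = j * s + h j" by simp
    have "i = j" "g i = h j"
      using block_index_eq[OF choiceD[OF assms(1) ij(1)] choiceD[OF assms(2) ij(2)] eq] by blast+
    then show "x \<in> (\<lambda>i. i * s + g i + 1) ` {i. i < k \<and> h i = g i}"
      using ij by (intro image_eqI[of _ _ i]) simp_all
  next
    fix x assume "x \<in> (\<lambda>i. i * s + g i + 1) ` {i. i < k \<and> h i = g i}"
    then obtain i where i: "i < k" "h i = g i" "x = i * s + g i + 1" by blast
    then have "x = i * s + h i + 1" by simp
    then show "x \<in> transversal s k g \<inter> transversal s k h"
      using i unfolding transversal_def by blast
  qed
  moreover have "inj_on (\<lambda>i. i * s + g i + 1) {i. i < k \<and> h i = g i}"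
    by (rule inj_on_subset[OF inj_on_transversal[OF assms(1)]]) auto
  ultimately show ?thesis by (simp add: card_image)
qed

lemma prob_transversal_independent:
  assumes p: "0 \<le> p" "p \<le> 1" and g: "g \<in> F"
  shows "measure_pmf.prob (random_graph n p) {E. E \<inter> pairs_of (transversal s k g) = {}}
    = (1 - p) ^ (k choose 2)"
  using pairs_of_subset_vertex_pairs[OF transversal_subset[OF g]]
  by (simp add: prob_avoid_edges[OF p] card_pairs_of finite_transversal card_transversal[OF g])

text \<open>Transversals with \<open>l\<close> common vertices share \<open>l choose 2\<close>
  pairs, so independence of the two events fails by the factor \<open>b ^ (l choose 2)\<close>. It
  is bounded by one factor per common vertex, which yields a product over the blocks.\<close>

lemma prob_two_transversals_independent:
  assumes p: "0 \<le> p" "p < 1" and g: "g \<in> F" and h: "h \<in> F"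
  defines "b \<equiv> 1 / (1 - p)"
  shows "measure_pmf.prob (random_graph n p)
      {E. E \<inter> pairs_of (transversal s k g) = {} \<and> E \<inter> pairs_of (transversal s k h) = {}}
    \<le> ((1 - p) ^ (k choose 2))\<^sup>2 * (\<Prod>i<k. if h i = g i then sqrt (b ^ k) else 1)"
proof -
  let ?g = "pairs_of (transversal s k g)" and ?h = "pairs_of (transversal s k h)"
  define l where "l = card {i. i < k \<and> h i = g i}"
  have b: "1 \<le> b" using p by (simp add: b_def field_simps)
  have l: "l \<le> k"
    unfolding l_def using card_mono[of "{..<k}" "{i. i < k \<and> h i = g i}"] by auto
  have "card (?g \<union> ?h) + (l choose 2) = card ?g + card ?h"
    using card_Un_Int[of ?g ?h] card_transversal_Int[OF g h]
    by (simp add: pairs_of_Int card_pairs_of finite_pairs_of finite_transversal l_def)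
  then have card: "card (?g \<union> ?h) + (l choose 2) = 2 * (k choose 2)"
    by (simp add: card_pairs_of finite_transversal card_transversal g h)
  have "measure_pmf.prob (random_graph n p) {E. E \<inter> ?g = {} \<and> E \<inter> ?h = {}}
      = measure_pmf.prob (random_graph n p) {E. E \<inter> (?g \<union> ?h) = {}}"
    by (intro arg_cong[where f = "measure_pmf.prob (random_graph n p)"]) auto
  also have "\<dots> = (1 - p) ^ card (?g \<union> ?h)"
    using p pairs_of_subset_vertex_pairs[OF transversal_subset] g h
    by (intro prob_avoid_edges) auto
  also have "\<dots> = (1 - p) ^ card (?g \<union> ?h) * ((1 - p) ^ (l choose 2) * b ^ (l choose 2))"
    using p by (simp add: b_def flip: power_mult_distrib)
  also have "\<dots> = (1 - p) ^ (card (?g \<union> ?h) + (l choose 2)) * b ^ (l choose 2)"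
    by (simp add: power_add)
  also have "\<dots> = ((1 - p) ^ (k choose 2))\<^sup>2 * b ^ (l choose 2)"
    unfolding card by (simp add: power_mult[symmetric] mult.commute)
  \<comment> \<open>The exponent, quadratic in \<open>l\<close>, is made linear by
    \<open>l * (l - 1) \<le> l * k\<close>. Comparing squares avoids the possibly fractional
    exponent \<open>k / 2\<close>.\<close>
  also have "b ^ (l choose 2) \<le> sqrt (b ^ k) ^ l"
  proof (rule power2_le_imp_le)
    have "(l choose 2) * 2 = l * (l - 1)"
      unfolding choose_two by (rule dvd_div_mult_self) (cases l; simp)
    then have "(b ^ (l choose 2))\<^sup>2 = b ^ (l * (l - 1))"
      by (simp only: power_mult[symmetric])
    also have "\<dots> \<le> b ^ (l * k)"
      using l b by (intro power_increasing mult_le_mono) auto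
    also have "\<dots> = ((sqrt (b ^ k))\<^sup>2) ^ l"
      using b by (simp add: power_mult[symmetric] mult.commute)
    also have "\<dots> = (sqrt (b ^ k) ^ l)\<^sup>2"
      by (simp only: power_mult[symmetric] mult.commute)
    finally show "(b ^ (l choose 2))\<^sup>2 \<le> (sqrt (b ^ k) ^ l)\<^sup>2" .
  qed (use b in simp)
  also have "sqrt (b ^ k) ^ l = (\<Prod>i<k. if h i = g i then sqrt (b ^ k) else 1)"
    by (simp add: prod.If_cases l_def Int_def)
  finally show ?thesis using p by (simp add: mult_left_mono)
qed

text \<open>Chebyshev's inequality for the number \<open>X\<close> of independent transversals. The
  ratio of the second moment to the squared mean is at most \<open>(1 + \<beta> / s) ^ k\<close>, as
  in each block the two choices agree for only one of \<open>s\<close> values.\<close>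

lemma prob_no_independent_transversal:
  assumes p: "0 \<le> p" "p < 1" and s: "0 < s"
  defines "b \<equiv> 1 / (1 - p)"
  shows "measure_pmf.prob (random_graph n p)
      {E. \<forall>g\<in>F. E \<inter> pairs_of (transversal s k g) \<noteq> {}} \<le> exp (k * sqrt (b ^ k) / s) - 1"
proof -
  let ?G = "random_graph n p"
  define \<beta> where "\<beta> = sqrt (b ^ k)"
  define q where "q = (1 - p) ^ (k choose 2)"
  define I where "I g = {E. E \<inter> pairs_of (transversal s k g) = {}}" for g
  define X where "X E = (\<Sum>g\<in>F. indicator (I g) E :: real)" for E
  define \<mu> where "\<mu> = real s ^ k * q"
  have \<mu>: "0 < \<mu>" using p s by (simp add: \<mu>_def q_def)
  have fin: "finite (set_pmf ?G)"
    by (rule finite_subset[of _ "Pow (vertex_pairs n)"])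
      (auto dest: random_graph_subset simp: finite_vertex_pairs)
  note int = integrable_measure_pmf_finite[OF fin]
  have \<beta>0: "0 \<le> \<beta>" using p by (simp add: \<beta>_def b_def)
  have EX: "measure_pmf.expectation ?G X = \<mu>"
  proof -
    have "measure_pmf.expectation ?G X = (\<Sum>g\<in>F. measure_pmf.prob ?G (I g))"
      unfolding X_def by (subst Bochner_Integration.integral_sum) (auto intro: int)
    also have "\<dots> = (\<Sum>g\<in>F. q)"
      using p by (intro sum.cong refl) (simp add: I_def q_def prob_transversal_independent)
    finally show ?thesis by (simp add: card_choices \<mu>_def)
  qed
  have EX2: "measure_pmf.expectation ?G (\<lambda>E. (X E)\<^sup>2) \<le> \<mu>\<^sup>2 * exp (k * \<beta> / s)"
  proof -
    have "measure_pmf.expectation ?G (\<lambda>E. (X E)\<^sup>2)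
        = measure_pmf.expectation ?G (\<lambda>E. \<Sum>g\<in>F. \<Sum>h\<in>F. indicator (I g \<inter> I h) E)"
      by (intro Bochner_Integration.integral_cong refl)
        (simp add: X_def power2_eq_square sum_product indicator_inter_arith)
    also have "\<dots> = (\<Sum>g\<in>F. \<Sum>h\<in>F. measure_pmf.prob ?G (I g \<inter> I h))"
      by (subst Bochner_Integration.integral_sum, rule int, intro sum.cong refl,
          subst Bochner_Integration.integral_sum) (auto intro: int)
    also have "\<dots> \<le> (\<Sum>g\<in>F. \<Sum>h\<in>F. q\<^sup>2 * (\<Prod>i<k. if h i = g i then \<beta> else 1))"
    proof (intro sum_mono)
      fix g h assume "g \<in> F" "h \<in> F"
      moreover have "I g \<inter> I h = {E. E \<inter> pairs_of (transversal s k g) = {} \<and>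
          E \<inter> pairs_of (transversal s k h) = {}}"
        by (auto simp only: I_def)
      ultimately show "measure_pmf.prob ?G (I g \<inter> I h) \<le> q\<^sup>2 * (\<Prod>i<k. if h i = g i then \<beta> else 1)"
        using prob_two_transversals_independent[OF p] by (simp only: q_def \<beta>_def b_def)
    qed
    \<comment> \<open>For fixed \<open>g\<close> the choices of \<open>h\<close> in the blocks are
      free, so the sum over \<open>h\<close> of the product is the product of the sums over single
      blocks.\<close>
    also have "\<dots> = (\<Sum>g\<in>F. q\<^sup>2 * (\<Prod>i<k. \<Sum>a<s. if a = g i then \<beta> else 1))"
      unfolding sum_distrib_left[symmetric] F_def
      by (intro sum.cong refl arg_cong2[where f = "(*)"]) (subst prod_sum_PiE, auto)
    also have "\<dots> \<le> (\<Sum>g\<in>F. q\<^sup>2 * (\<Prod>i<k. real s + \<beta>))"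
    proof (intro sum_mono mult_left_mono prod_mono conjI)
      fix g i assume g: "g \<in> F" and i: "i \<in> {..<k}"
      have "(\<Sum>a<s. if a = g i then \<beta> else 1) \<le> (\<Sum>a<s. 1 + (if a = g i then \<beta> else 0))"
        using \<beta>0 by (intro sum_mono) auto
      also have "\<dots> = real s + \<beta>"
        using choiceD[OF g] i by (simp add: sum.distrib)
      finally show "(\<Sum>a<s. if a = g i then \<beta> else 1) \<le> real s + \<beta>" .
    qed (use \<beta>0 in \<open>auto intro!: sum_nonneg\<close>)
    also have "\<dots> = \<mu>\<^sup>2 * (1 + \<beta> / s) ^ k"
    proof -
      have "real s + \<beta> = real s * (1 + \<beta> / s)"
        using s by (simp add: field_simps)
      then show ?thesis
        by (simp add: card_choices \<mu>_def power_mult_distrib power2_eq_square)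
    qed
    also have "(1 + \<beta> / s) ^ k \<le> exp (\<beta> / s) ^ k"
      using \<beta>0 by (intro power_mono) auto
    also have "exp (\<beta> / s) ^ k = exp (k * \<beta> / s)"
      by (simp add: exp_of_nat_mult[symmetric])
    finally show ?thesis by (simp add: mult_left_mono)
  qed
  have "\<mu>\<^sup>2 * measure_pmf.prob ?G {E. \<forall>g\<in>F. E \<notin> I g}
      = measure_pmf.expectation ?G (\<lambda>E. \<mu>\<^sup>2 * indicator {E. \<forall>g\<in>F. E \<notin> I g} E)"
    by simp
  \<comment> \<open>Where no transversal is independent, \<open>X E = 0\<close> and the integrand on
    the right equals \<open>\<mu>\<^sup>2\<close>.\<close>
  also have "\<dots> \<le> measure_pmf.expectation ?G (\<lambda>E. (X E - \<mu>)\<^sup>2)"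
    by (intro integral_mono int) (auto simp: X_def indicator_def intro!: sum.neutral)
  also have "\<dots> = measure_pmf.expectation ?G (\<lambda>E. (X E)\<^sup>2) - 2 * \<mu> * measure_pmf.expectation ?G X + \<mu>\<^sup>2"
    by (simp add: power2_diff int algebra_simps)
  also have "\<dots> \<le> \<mu>\<^sup>2 * (exp (k * \<beta> / s) - 1)"
    using EX2 unfolding EX by (simp add: power2_eq_square algebra_simps)
  finally have "measure_pmf.prob ?G {E. \<forall>g\<in>F. E \<notin> I g} \<le> exp (k * \<beta> / s) - 1"
    using \<mu> by simp
  then show ?thesis by (simp add: I_def \<beta>_def)
qed

end

text \<open>Outside the two bad events, the greedy set and an independent transversal with
  \<open>Suc j\<close> vertices witness \<open>not_cohen_macaulay_graph\<close>. The edge set is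
  known to consist of vertex pairs only on the support, hence the intersection with
  \<open>set_pmf\<close>.\<close>

lemma prob_cohen_macaulay_graph_le:
  fixes p :: real and n j s :: nat
  assumes p: "0 \<le> p" "p < 1" and s: "0 < s" and size: "Suc j * s \<le> n"
  defines "b \<equiv> 1 / (1 - p)"
  shows "measure_pmf.prob (random_graph n p) {E. cohen_macaulay_graph TYPE('k::field) n E}
    \<le> n * (1 - p) ^ j + (exp (Suc j * sqrt (b ^ Suc j) / s) - 1)"
proof -
  let ?G = "random_graph n p" and ?CM = "{E. cohen_macaulay_graph TYPE('k) n E}"
  define F where "F = {..<Suc j} \<rightarrow>\<^sub>E {..<s}"
  let ?A = "{E. j < card (greedy E n)}"
  let ?B = "{E. \<forall>g\<in>F. E \<inter> pairs_of (transversal s (Suc j) g) \<noteq> {}}"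
  have "?CM \<inter> set_pmf ?G \<subseteq> ?A \<union> ?B"
  proof
    fix E assume "E \<in> ?CM \<inter> set_pmf ?G"
    then have CM: "cohen_macaulay_graph TYPE('k) n E" and E: "E \<subseteq> vertex_pairs n"
      by (auto dest: random_graph_subset)
    show "E \<in> ?A \<union> ?B"
    proof (rule ccontr)
      assume "E \<notin> ?A \<union> ?B"
      then obtain g where g: "g \<in> F" "E \<inter> pairs_of (transversal s (Suc j) g) = {}"
          and small: "card (greedy E n) \<le> j"
        by auto
      let ?T = "transversal s (Suc j) g"
      have T: "?T \<subseteq> {1..n}" "card ?T = Suc j"
        using g(1) transversal_subset[OF size] card_transversal[OF size] by (simp_all add: F_def)
      have "independent_set n E ?T"
        using independent_set_iff_pairs_of[OF E T(1)] g(2) by simp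
      moreover have "card (greedy E n) < card ?T" using small T(2) by simp
      ultimately show False
        using not_cohen_macaulay_graph[OF E maximal_independent_set_greedy[OF E]] CM by blast
    qed
  qed
  then have "measure_pmf.prob ?G (?CM \<inter> set_pmf ?G) \<le> measure_pmf.prob ?G (?A \<union> ?B)"
    by (rule measure_pmf.finite_measure_mono) simp
  then have "measure_pmf.prob ?G ?CM \<le> measure_pmf.prob ?G (?A \<union> ?B)"
    by (simp only: measure_Int_set_pmf)
  also have "\<dots> \<le> measure_pmf.prob ?G ?A + measure_pmf.prob ?G ?B"
    by (rule measure_Un_le) auto
  also have "\<dots> \<le> n * (1 - p) ^ j + (exp (Suc j * sqrt (b ^ Suc j) / s) - 1)"
    unfolding b_def F_def
    using p by (intro add_mono prob_greedy_large prob_no_independent_transversal[OF size p s]) auto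
  finally show ?thesis .
qed

theorem corollary7p10:
  fixes p :: real
  assumes "0 < p" and "p < 1"
  shows "(\<lambda>n. measure_pmf.prob (random_graph n p)
            {E. \<not> cohen_macaulay_graph TYPE('k::field) n E}) \<longlonglongrightarrow> 1"
proof -
  \<comment> \<open>\<open>L\<close> equals \<open>ln b\<close>, so \<open>ln (real n) / L\<close>
    is the logarithm of \<open>n\<close> to base \<open>b\<close>.\<close>
  define L where "L = - ln (1 - p)"
  define b where "b = 1 / (1 - p)"
  \<comment> \<open>An upper bound for \<open>Suc j\<close> free of rounding: one unit for the
    ceiling in \<open>j\<close> and one for the successor.\<close>
  define K where "K n = 3/2 * ln (real n) / L + 2" for n
  define err where "err n = real n * exp (- (3/2 * ln (real n)))
    + (exp (2 * (K n)\<^sup>2 * exp (3/4 * ln (real n) + L) / real n) - 1)" for n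
  let ?CM = "\<lambda>n. {E. cohen_macaulay_graph TYPE('k) n E}"
  have L: "0 < L" using assms by (simp add: L_def)
  have expL: "1 - p = exp (- L)" "b = exp L"
    using assms by (simp_all add: L_def b_def exp_minus inverse_eq_divide)
  have bound: "measure_pmf.prob (random_graph n p) (?CM n) \<le> err n"
    if n: "1 \<le> n" and Kn: "K n \<le> n / 2" for n
  proof -
    define j where "j = nat \<lceil>3/2 * ln (real n) / L\<rceil>"
    define s where "s = n div Suc j"
    have lnn: "0 \<le> 3/2 * ln (real n) / L" using n L by simp
    have j: "3/2 * ln (real n) / L \<le> j" "Suc j \<le> K n"
      using lnn unfolding j_def K_def by linarith+
    have size: "Suc j * s \<le> n" unfolding s_def by (rule times_div_less_eq_dividend)
    \<comment> \<open>Rounding down in \<open>s\<close> loses less than 1, and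
      \<open>real n / Suc j\<close> is at least 2 because
      \<open>Suc j \<le> K n \<le> n / 2\<close>; so at most half of the block length is
      lost.\<close>
    have "n \<le> Suc j + Suc j * s"
      unfolding s_def using dividend_less_times_div[of "Suc j" n] by simp
    then have "real n \<le> Suc j + Suc j * real s"
      by (simp only: of_nat_le_iff[symmetric, where 'a=real] of_nat_add of_nat_mult)
    then have "real n / Suc j \<le> s + 1"
      by (simp add: field_simps)
    moreover have "1 \<le> real n / Suc j / 2"
      using j(2) Kn by (simp add: field_simps)
    ultimately have s: "real n / (2 * Suc j) \<le> s" by (simp add: field_simps)
    have s0: "0 < s"
      unfolding s_def using j(2) Kn by (simp add: div_greater_zero_iff)
    have "measure_pmf.prob (random_graph n p) (?CM n)
        \<le> n * (1 - p) ^ j + (exp (Suc j * sqrt (b ^ Suc j) / s) - 1)"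
      unfolding b_def using assms by (intro prob_cohen_macaulay_graph_le s0 size) auto
    also have "(1 - p) ^ j \<le> exp (- (3/2 * ln (real n)))"
      using j(1) L by (simp add: expL exp_of_nat_mult[symmetric] field_simps)
    also have "Suc j * sqrt (b ^ Suc j) / s \<le> 2 * (K n)\<^sup>2 * exp (3/4 * ln (real n) + L) / real n"
    proof -
      have "b ^ Suc j = exp (Suc j * L)" unfolding expL by (rule exp_of_nat_mult[symmetric])
      also have "\<dots> \<le> exp (K n * L)" using j(2) L by simp
      \<comment> \<open>Written as a double, so that the exponential is a perfect square and the
        square root can be taken.\<close>
      also have "K n * L = 2 * (3/4 * ln (real n) + L)" using L by (simp add: K_def field_simps)
      also have "exp \<dots> = (exp (3/4 * ln (real n) + L))\<^sup>2" by (rule exp_double)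
      finally have sqrt: "sqrt (b ^ Suc j) \<le> exp (3/4 * ln (real n) + L)"
        by (simp add: real_le_lsqrt)
      have "Suc j * sqrt (b ^ Suc j) / s \<le> Suc j * sqrt (b ^ Suc j) / (real n / (2 * Suc j))"
        using s s0 n assms by (intro divide_left_mono mult_pos_pos) (auto simp: b_def)
      also have "\<dots> = 2 * (real (Suc j))\<^sup>2 * sqrt (b ^ Suc j) / real n"
        by (simp add: power2_eq_square)
      also have "\<dots> \<le> 2 * (K n)\<^sup>2 * exp (3/4 * ln (real n) + L) / real n"
        using j(2) sqrt assms by (intro divide_right_mono mult_mono power_mono) (auto simp: b_def)
      finally show ?thesis .
    qed
    finally show ?thesis by (simp add: err_def mult_left_mono)
  qed
  have "eventually (\<lambda>n. K n \<le> real n / 2) at_top"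
    unfolding K_def using L by real_asymp
  then have upper: "eventually (\<lambda>n. measure_pmf.prob (random_graph n p) (?CM n) \<le> err n) at_top"
    using eventually_ge_at_top[of 1] by eventually_elim (rule bound)
  have "err \<longlonglongrightarrow> 0"
    unfolding err_def K_def using L by real_asymp
  then have "(\<lambda>n. measure_pmf.prob (random_graph n p) (?CM n)) \<longlonglongrightarrow> 0"
    by (rule tendsto_sandwich[OF always_eventually upper tendsto_const, rotated]) simp
  from tendsto_diff[OF tendsto_const[of 1] this]
  have "(\<lambda>n. 1 - measure_pmf.prob (random_graph n p) (?CM n)) \<longlonglongrightarrow> 1"
    by simp
  moreover have "measure_pmf.prob (random_graph n p) {E. \<not> cohen_macaulay_graph TYPE('k) n E}
      = 1 - measure_pmf.prob (random_graph n p) (?CM n)" for n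
    using measure_pmf.prob_compl[of "?CM n" "random_graph n p"]
    by (simp add: Compl_eq_Diff_UNIV[symmetric] Collect_neg_eq[symmetric])
  ultimately show ?thesis by simp
qed

end
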